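(* Let $d\ge1$, and let $H:\mathbb{R}^d\times\mathbb{R}^d\to\mathbb{R}$ and $G:\mathbb{R}^d\to\mathbb{R}$ be $C^2$ functions with uniformly bounded second order derivatives. Suppose furthermore that $H(x,\cdot)$ is strongly convex, uniformly in $x$ (i.e. there is $c_0>0$ with $\partial_{pp}H(x,p)\ge c_0 I$ for all $(x,p)$). Then the following hold. (1) There exists a constant $C>0$ depending only on $\|D^2G\|_\infty$, $\|D^2H\|_\infty$ and the lower bound $c_0$ on $\partial_{pp}H$ such that, whenever $\alpha>C$, the problem $$-\partial_t u(t,x)+\tilde H(x,\partial_x u(t,x))=0\ \text{ in }(0,T)\times\mathbb{R}^d,\qquad u(T,x)=G(x),\ x\in\mathbb{R}^d,$$ with $\tilde H(x,p):=H(x,p)+\alpha\, x\cdot p$ is globally well-posed in the class $C^{1,1}_{\mathrm{loc}}([0,T]\times\mathbb{R}^d)$ for any $T>0$. (2) There exists a constant $C>0$ depending only on $\|D^2G\|_\infty$, $\|D^2H\|_\infty$ and the lower bound $c_0$ on $\partial_{pp}H$ such that, whenever $\alpha>C$, the problem $$-\partial_t u(t,x)+\tilde H(x,\partial_x u(t,x))=0\ \text{ in }(0,T)\times\mathbb{R}^d,\qquad u(T,x)=G(x),\ x\in\mathbb{R}^d,$$ with $\tilde H(x,p):=H(x,p)-\alpha\frac{|x|^2}{2}$ is globally well-posed in the class $C^{1,1}_{\mathrm{loc}}([0,T]\times\mathbb{R}^d)$ for any $T>0$.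
   Context: $\partial_x$ denotes the gradient in $x\in\mathbb{R}^d$; $\partial_{pp}H$ is the Hessian matrix of $H$ in the variable $p$; $D^2$ denotes the full Hessian; $\|\cdot\|_\infty$ of a matrix-valued function is the supremum over all points of the operator norm. "Globally well-posed in the class $C^{1,1}_{\mathrm{loc}}([0,T]\times\mathbb{R}^d)$" means that the terminal value problem has a unique classical solution $u\in C^{1,1}_{\mathrm{loc}}([0,T]\times\mathbb{R}^d)$, i.e. a unique function $u$ that is $C^1$ with locally Lipschitz first derivatives on $[0,T]\times\mathbb{R}^d$, satisfies the equation pointwise, and satisfies the terminal condition. *)

theory Defs
  imports "HOL-Analysis.Analysis"
begin

section \<open>Euclidean spaces of all dimensions inside one type\<close>

text \<open>
  The constants of the theorem must not depend on the dimension, so the dimension has to be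
  quantified inside the formula. All spaces \<open>\<real>\<^sup>d\<close> are therefore realised inside the
  Hilbert space of square-summable real sequences, \<open>\<real>\<^sup>d\<close> being the sequences
  supported on the first \<open>d\<close> indices, with the inherited inner product, norm and topology.
\<close>

typedef l2 = "{x :: nat \<Rightarrow> real. summable (\<lambda>i. (x i)\<^sup>2)}"
  morphisms coord mk_l2
  by (rule exI[of _ "\<lambda>_. 0"]) simp

lemma summable_coord_mult: "summable (\<lambda>i. coord x i * coord y i)"
proof (rule summable_comparison_test')
  show "summable (\<lambda>i. (coord x i)\<^sup>2 + (coord y i)\<^sup>2)"
    using coord[of x] coord[of y] by (auto intro: summable_add)
  fix n :: nat
  have "0 \<le> (\<bar>coord x n\<bar> - \<bar>coord y n\<bar>)\<^sup>2"
    by simp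
  then have "2 * (\<bar>coord x n\<bar> * \<bar>coord y n\<bar>) \<le> (coord x n)\<^sup>2 + (coord y n)\<^sup>2"
    by (simp add: power2_diff)
  moreover have "0 \<le> \<bar>coord x n\<bar> * \<bar>coord y n\<bar>"
    by simp
  ultimately show "norm (coord x n * coord y n) \<le> (coord x n)\<^sup>2 + (coord y n)\<^sup>2"
    unfolding real_norm_def abs_mult by linarith
qed

lemma l2_eqI: "(\<And>i. coord x i = coord y i) \<Longrightarrow> x = y"
  by (simp add: coord_inject[symmetric] ext)

instantiation l2 :: real_inner
begin

definition zero_l2 :: l2 where "0 = mk_l2 (\<lambda>_. 0)"
definition plus_l2 :: "l2 \<Rightarrow> l2 \<Rightarrow> l2" where "x + y = mk_l2 (\<lambda>i. coord x i + coord y i)"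
definition minus_l2 :: "l2 \<Rightarrow> l2 \<Rightarrow> l2" where "x - y = mk_l2 (\<lambda>i. coord x i - coord y i)"
definition uminus_l2 :: "l2 \<Rightarrow> l2" where "- x = mk_l2 (\<lambda>i. - coord x i)"
definition scaleR_l2 :: "real \<Rightarrow> l2 \<Rightarrow> l2" where "scaleR c x = mk_l2 (\<lambda>i. c * coord x i)"
definition inner_l2 :: "l2 \<Rightarrow> l2 \<Rightarrow> real" where "inner x y = (\<Sum>i. coord x i * coord y i)"
definition norm_l2 :: "l2 \<Rightarrow> real" where "norm (x :: l2) = sqrt (inner x x)"
definition dist_l2 :: "l2 \<Rightarrow> l2 \<Rightarrow> real" where "dist x y = norm (x - y :: l2)"
definition sgn_l2 :: "l2 \<Rightarrow> l2" where "sgn x = inverse (norm x) *\<^sub>R (x :: l2)"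
definition uniformity_l2 :: "(l2 \<times> l2) filter"
  where "uniformity = (INF e\<in>{0<..}. principal {(x :: l2, y). dist x y < e})"
definition open_l2 :: "l2 set \<Rightarrow> bool"
  where "open U = (\<forall>x\<in>U. \<forall>\<^sub>F (x', y) in uniformity. x' = (x :: l2) \<longrightarrow> y \<in> U)"

lemma coord_zero [simp]: "coord 0 i = 0"
  by (simp add: zero_l2_def mk_l2_inverse)

lemma coord_plus [simp]: "coord (x + y) i = coord x i + coord y i"
proof -
  have "summable (\<lambda>i. (coord x i)\<^sup>2 + (coord y i)\<^sup>2 + 2 * (coord x i * coord y i))"
    using coord[of x] coord[of y]
    by (auto intro!: summable_add summable_mult summable_coord_mult)
  then have "summable (\<lambda>i. (coord x i + coord y i)\<^sup>2)"
    by (simp add: power2_sum mult.assoc)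
  then show ?thesis
    by (simp add: plus_l2_def mk_l2_inverse)
qed

lemma coord_scaleR [simp]: "coord (c *\<^sub>R x) i = c * coord x i"
proof -
  have "summable (\<lambda>i. (c * coord x i)\<^sup>2)"
    using coord[of x] by (simp add: power_mult_distrib summable_mult)
  then show ?thesis
    by (simp add: scaleR_l2_def mk_l2_inverse)
qed

lemma coord_uminus [simp]: "coord (- x) i = - coord x i"
  using coord[of x] by (simp add: uminus_l2_def mk_l2_inverse)

lemma coord_minus [simp]: "coord (x - y) i = coord x i - coord y i"
proof -
  have "x - y = x + (- y)"
    unfolding minus_l2_def plus_l2_def by simp
  then show ?thesis
    by simp
qed

instance
proof
  fix x y z :: l2 and a b :: real and U :: "l2 set"
  show "x + y + z = x + (y + z)" "x + y = y + x" "0 + x = x" "- x + x = 0" "x - y = x + - y"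
    "a *\<^sub>R (x + y) = a *\<^sub>R x + a *\<^sub>R y" "(a + b) *\<^sub>R x = a *\<^sub>R x + b *\<^sub>R x"
    "a *\<^sub>R b *\<^sub>R x = (a * b) *\<^sub>R x" "1 *\<^sub>R x = x"
    by (auto intro!: l2_eqI simp: algebra_simps)
  show "dist x y = norm (x - y)" "sgn x = inverse (norm x) *\<^sub>R x"
    "norm x = sqrt (inner x x)"
    "uniformity = (INF e\<in>{0<..}. principal {(x :: l2, y). dist x y < e})"
    "open U = (\<forall>x\<in>U. \<forall>\<^sub>F (x', y) in uniformity. x' = x \<longrightarrow> y \<in> U)"
    by (simp_all add: dist_l2_def sgn_l2_def norm_l2_def uniformity_l2_def open_l2_def)
  show "inner x y = inner y x"
    by (simp add: inner_l2_def mult.commute)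
  show "inner (x + y) z = inner x z + inner y z"
    by (simp add: inner_l2_def distrib_right suminf_add summable_coord_mult)
  show "inner (a *\<^sub>R x) y = a * inner x y"
    by (simp add: inner_l2_def mult.assoc suminf_mult summable_coord_mult)
  show "0 \<le> inner x x"
    by (simp add: inner_l2_def suminf_nonneg summable_coord_mult)
  show "inner x x = 0 \<longleftrightarrow> x = 0"
  proof
    assume "inner x x = 0"
    then have "\<forall>i. coord x i * coord x i = 0"
      using suminf_eq_zero_iff[OF summable_coord_mult[of x x]] by (simp add: inner_l2_def)
    then show "x = 0"
      by (auto intro: l2_eqI)
  qed (simp add: inner_l2_def)
qed

end

definition Rd :: "nat \<Rightarrow> l2 set" where
  "Rd d = {x. \<forall>i\<ge>d. coord x i = 0}"

lemma subspace_Rd: "subspace (Rd d)"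
  by (auto simp: subspace_def Rd_def)

lemma inner_Rd: "x \<in> Rd d \<Longrightarrow> inner x y = (\<Sum>i<d. coord x i * coord y i)"
  unfolding inner_l2_def by (rule suminf_finite) (auto simp: Rd_def not_less)

lemma bij_betw_Rd: "bij_betw (\<lambda>x. restrict (coord x) {..<d}) (Rd d) ({..<d} \<rightarrow>\<^sub>E UNIV)"
proof (rule bij_betw_imageI)
  show "inj_on (\<lambda>x. restrict (coord x) {..<d}) (Rd d)"
  proof (rule inj_onI, rule l2_eqI)
    fix x y i
    assume "x \<in> Rd d" "y \<in> Rd d"
      and "restrict (coord x) {..<d} = restrict (coord y) {..<d}"
    then have "x \<in> Rd d" "y \<in> Rd d"
      and "restrict (coord x) {..<d} i = restrict (coord y) {..<d} i"
      by metis+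
    then show "coord x i = coord y i"
      by (cases "i < d") (simp_all add: Rd_def)
  qed
  show "(\<lambda>x. restrict (coord x) {..<d}) ` Rd d = {..<d} \<rightarrow>\<^sub>E UNIV"
  proof (intro equalityI subsetI)
    fix f :: "nat \<Rightarrow> real"
    assume f: "f \<in> {..<d} \<rightarrow>\<^sub>E UNIV"
    define x where "x = mk_l2 (\<lambda>i. if i < d then f i else 0)"
    have "summable (\<lambda>i. (if i < d then f i else 0)\<^sup>2)"
      by (rule summable_finite[of "{..<d}"]) auto
    then have x: "coord x = (\<lambda>i. if i < d then f i else 0)"
      by (simp add: x_def mk_l2_inverse)
    have "x \<in> Rd d" "f = restrict (coord x) {..<d}"
      using f by (auto simp: Rd_def x fun_eq_iff PiE_def extensional_def)
    then show "f \<in> (\<lambda>x. restrict (coord x) {..<d}) ` Rd d"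
      by blast
  qed (auto split: if_splits)
qed


section \<open>Gradients and Hessians on a subspace\<close>

text \<open>
  A real function on a finite-dimensional space \<open>V\<close> is represented by a function on an ambient
  inner product type of which only the values on \<open>V\<close> matter; accordingly derivatives are taken
  within \<open>V\<close>. The gradient is the Riesz representative in \<open>V\<close> of the derivative. The Hessian
  is the derivative of the gradient, viewed as a linear map; it is determined (and only used)
  on directions in \<open>V\<close>.
\<close>

definition gradient :: "'a::real_inner set \<Rightarrow> ('a \<Rightarrow> real) \<Rightarrow> 'a \<Rightarrow> 'a" where
  "gradient V f x = (THE g. g \<in> V \<and> (f has_derivative (\<lambda>h. inner g h)) (at x within V))"

definition hessian :: "'a::real_inner set \<Rightarrow> ('a \<Rightarrow> real) \<Rightarrow> 'a \<Rightarrow> 'a \<Rightarrow> 'a" where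
  "hessian V f x = frechet_derivative (gradient V f) (at x within V)"

lemma has_derivative_within_subspace_unique:
  fixes f :: "'a::real_normed_vector \<Rightarrow> 'b::real_normed_vector"
  assumes V: "subspace V" "x \<in> V" "h \<in> V"
    and A: "(f has_derivative A) (at x within V)" and B: "(f has_derivative B) (at x within V)"
  shows "A h = B h"
proof -
  have *: "((\<lambda>s. f (x + s *\<^sub>R h)) has_vector_derivative D h) (at 0)"
    if D: "(f has_derivative D) (at x within V)" for D
  proof -
    have line: "((\<lambda>s. x + s *\<^sub>R h) has_derivative (\<lambda>s. s *\<^sub>R h)) (at (0::real))"
      by (auto intro!: derivative_eq_intros)
    have "x + s *\<^sub>R h \<in> V" for s
      using V by (simp add: subspace_add subspace_scale)
    then have "((\<lambda>s. f (x + s *\<^sub>R h)) has_derivative (\<lambda>s. D (s *\<^sub>R h))) (at 0)"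
      using has_derivative_in_compose2[OF _ _ _ line, of V f "\<lambda>_. D"]
        has_derivative_in_compose[OF line, of f D] has_derivative_subset[OF D] 
      by (auto simp: image_subset_iff)
    then show ?thesis
      using linear_scale[OF has_derivative_linear[OF D]]
      by (simp add: has_vector_derivative_def)
  qed
  show ?thesis
    using vector_derivative_unique_at[OF *[OF A] *[OF B]] .
qed

lemma gradient_eqI:
  assumes "subspace V" "x \<in> V" "g \<in> V" "(f has_derivative (\<lambda>h. inner g h)) (at x within V)"
  shows "gradient V f x = g"
  unfolding gradient_def
proof (rule the_equality)
  fix g'
  assume g': "g' \<in> V \<and> (f has_derivative (\<lambda>h. inner g' h)) (at x within V)"
  then have "g' - g \<in> V"
    using assms by (simp add: subspace_diff)
  then have "inner g' (g' - g) = inner g (g' - g)"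
    using g' assms has_derivative_within_subspace_unique by blast
  then have "inner (g' - g) (g' - g) = 0"
    by (simp add: inner_diff_left)
  then show "g' = g"
    by simp
qed (use assms in simp)

definition C2_on :: "'a::real_inner set \<Rightarrow> ('a \<Rightarrow> real) \<Rightarrow> bool" where
  "C2_on V f \<longleftrightarrow> f differentiable_on V \<and> gradient V f differentiable_on V \<and>
     (\<forall>h\<in>V. continuous_on V (\<lambda>x. hessian V f x h))"

definition bounded_hessian :: "'a::real_inner set \<Rightarrow> ('a \<Rightarrow> real) \<Rightarrow> bool" where
  "bounded_hessian V f \<longleftrightarrow>
     (\<exists>B. \<forall>x\<in>V. \<forall>h\<in>V. norm h \<le> 1 \<longrightarrow> norm (hessian V f x h) \<le> B)"

text \<open>The operator norm on \<open>V\<close>, maximised over all points; meaningful for \<^const>\<open>bounded_hessian\<close>.\<close>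

definition hessian_norm :: "'a::real_inner set \<Rightarrow> ('a \<Rightarrow> real) \<Rightarrow> real" where
  "hessian_norm V f = (SUP x\<in>V. SUP h\<in>{h\<in>V. norm h \<le> 1}. norm (hessian V f x h))"

definition strongly_convex_in_p :: "'a::real_inner set \<Rightarrow> ('a \<Rightarrow> 'a \<Rightarrow> real) \<Rightarrow> real \<Rightarrow> bool" where
  "strongly_convex_in_p V H c \<longleftrightarrow>
     (\<forall>x\<in>V. \<forall>p\<in>V. \<forall>h\<in>V. inner (hessian V (H x) p h) h \<ge> c * inner h h)"


section \<open>The terminal value problem\<close>

definition time_deriv :: "real \<Rightarrow> (real \<Rightarrow> 'a \<Rightarrow> real) \<Rightarrow> real \<Rightarrow> 'a \<Rightarrow> real" where
  "time_deriv T u t x = vector_derivative (\<lambda>s. u s x) (at t within {0..T})"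

definition space_grad ::
    "'a::real_inner set \<Rightarrow> (real \<Rightarrow> 'a \<Rightarrow> real) \<Rightarrow> real \<Rightarrow> 'a \<Rightarrow> 'a" where
  "space_grad V u t x = gradient V (u t) x"

definition locally_lipschitz_on ::
    "'a::metric_space set \<Rightarrow> ('a \<Rightarrow> 'b::metric_space) \<Rightarrow> bool" where
  "locally_lipschitz_on S f \<longleftrightarrow> (\<forall>z\<in>S. \<exists>r>0. \<exists>L. L-lipschitz_on (cball z r \<inter> S) f)"

text \<open>
  Continuity of the first partial derivatives, hence \<open>C\<^sup>1\<close> on \<open>[0,T] \<times> V\<close> (one-sided
  in time at the end points), is implied by their being locally Lipschitz.
\<close>

definition C11_loc :: "'a::real_inner set \<Rightarrow> real \<Rightarrow> (real \<Rightarrow> 'a \<Rightarrow> real) \<Rightarrow> bool" where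
  "C11_loc V T u \<longleftrightarrow>
     (\<forall>t\<in>{0..T}. \<forall>x\<in>V. (\<lambda>s. u s x) differentiable (at t within {0..T}) \<and>
        u t differentiable (at x within V)) \<and>
     locally_lipschitz_on ({0..T} \<times> V) (\<lambda>(t, x). time_deriv T u t x) \<and>
     locally_lipschitz_on ({0..T} \<times> V) (\<lambda>(t, x). space_grad V u t x)"

definition classical_solution ::
    "'a::real_inner set \<Rightarrow> ('a \<Rightarrow> 'a \<Rightarrow> real) \<Rightarrow> ('a \<Rightarrow> real) \<Rightarrow> real \<Rightarrow> (real \<Rightarrow> 'a \<Rightarrow> real) \<Rightarrow> bool"
  where
  "classical_solution V H G T u \<longleftrightarrow>
     C11_loc V T u \<and>
     (\<forall>t\<in>{0<..<T}. \<forall>x\<in>V. - time_deriv T u t x + H x (space_grad V u t x) = 0) \<and>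
     (\<forall>x\<in>V. u T x = G x)"

definition well_posed ::
    "'a::real_inner set \<Rightarrow> ('a \<Rightarrow> 'a \<Rightarrow> real) \<Rightarrow> ('a \<Rightarrow> real) \<Rightarrow> real \<Rightarrow> bool" where
  "well_posed V H G T \<longleftrightarrow>
     (\<exists>u. classical_solution V H G T u \<and>
        (\<forall>v. classical_solution V H G T v \<longrightarrow> (\<forall>t\<in>{0..T}. \<forall>x\<in>V. v t x = u t x)))"

definition admissible_data ::
    "'a::real_inner set \<Rightarrow> ('a \<Rightarrow> 'a \<Rightarrow> real) \<Rightarrow> ('a \<Rightarrow> real) \<Rightarrow> real \<Rightarrow> bool" where
  "admissible_data V H G c \<longleftrightarrow>
     C2_on (V \<times> V) (\<lambda>(x, p). H x p) \<and> bounded_hessian (V \<times> V) (\<lambda>(x, p). H x p) \<and>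
     C2_on V G \<and> bounded_hessian V G \<and>
     c > 0 \<and> strongly_convex_in_p V H c"

end

theory Submission
  imports Defs
begin

text \<open>
  Reverse time, \<open>s = T - t\<close>. The characteristics of the equation solve the Hamiltonian system
  \<open>X' = H\<^sub>p(X, P)\<close>, \<open>P' = - H\<^sub>x(X, P)\<close> with \<open>X = y\<close>, \<open>P = DG(y)\<close> at \<open>s = 0\<close>; its right-hand side is
  globally Lipschitz, so they exist for all times. If \<open>y \<mapsto> X(s, y)\<close> is bijective with a Lipschitz
  inverse for every \<open>s\<close>, then the solution is obtained by transporting values along the
  characteristics and has gradient \<open>P(s, X(s, \<cdot>)\<^sup>-\<^sup>1)\<close>. The only thing that can go wrong is that
  characteristics cross, and a large \<open>\<alpha>\<close> forbids it.

  Write \<open>\<delta>\<close> for the difference of two characteristics and consider \<open>\<delta>X \<bullet> \<delta>P + m |\<delta>X|\<^sup>2\<close>. Its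
  derivative is \<open>\<delta>P \<bullet> \<delta>H\<^sub>p - \<delta>X \<bullet> \<delta>H\<^sub>x + 2 m \<delta>X \<bullet> \<delta>H\<^sub>p\<close>. Strong convexity contributes \<open>c\<^sub>0 |\<delta>P|\<^sup>2\<close>. The
  added term contributes at least \<open>\<alpha> |\<delta>X|\<^sup>2\<close>: for \<open>\<alpha> x \<bullet> p\<close> the first two differences cancel and
  \<open>2 m \<alpha> |\<delta>X|\<^sup>2\<close> remains, for \<open>- \<alpha> |x|\<^sup>2 / 2\<close> it comes from \<open>- \<delta>X \<bullet> \<delta>H\<^sub>x\<close>. All other terms are bounded by
  \<open>|\<delta>X| (|\<delta>X| + |\<delta>P|)\<close> times a constant built from \<open>m\<close> and \<open>\<parallel>D\<^sup>2H\<parallel>\<close>, so for large \<open>\<alpha>\<close> the quantity is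
  nondecreasing in \<open>s\<close> (\<open>H_mono_deficit\<close>). With \<open>m = \<parallel>D\<^sup>2G\<parallel> + 1\<close> it is at least \<open>|\<delta>y|\<^sup>2\<close> at
  \<open>s = 0\<close>. Together with the Lipschitz bound for the flow this gives \<open>|\<delta>y| \<le> \<kappa> |\<delta>X|\<close>
  (\<open>X_lower_bound\<close>), and a continuation argument in \<open>s\<close> shows that \<open>X(s, \<cdot>)\<close> is onto (\<open>X_onto\<close>).
  The time \<open>T\<close> enters \<open>\<kappa>\<close> but not the threshold for \<open>\<alpha>\<close>.

  Derivatives of the flow are avoided throughout. Existence rests on the first order expansion
  \<open>\<delta>U = P \<bullet> \<delta>X + O(|\<delta>X|\<^sup>2)\<close> of the transported values (\<open>U_expansion\<close>), which by the lower bound is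
  an expansion in the space variable. For uniqueness, the gradient of any solution is compared
  with \<open>P\<close> along the characteristics of the constructed one; difference quotients of size \<open>\<epsilon>\<close>
  give a Gronwall inequality for the discrepancy (\<open>vx_along_characteristic\<close>), and since the
  characteristics cover the whole space the two gradients agree everywhere.
\<close>

section \<open>Square-summable sequences and the truncation onto finitely many coordinates\<close>

lemma abs_coord_le_norm: "\<bar>coord x i\<bar> \<le> norm x"
proof -
  have "(\<Sum>j\<in>{i}. coord x j * coord x j) \<le> (\<Sum>j. coord x j * coord x j)"
    by (rule sum_le_suminf) (auto intro: summable_coord_mult)
  then have "(coord x i)\<^sup>2 \<le> inner x x"
    by (simp add: inner_l2_def power2_eq_square)
  then show ?thesis
    by (simp add: norm_eq_sqrt_inner real_le_rsqrt)
qed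

lemma bounded_linear_coord: "bounded_linear (\<lambda>x. coord x i)"
  by (rule bounded_linear_intro[of _ 1]) (auto simp: abs_coord_le_norm)

text \<open>
  Completeness is what lets the Picard iteration run in the whole ambient space. A Cauchy
  sequence converges coordinatewise; bounding the partial sums of the squared differences before
  letting the second index tend to infinity gives convergence in norm.
\<close>

instance l2 :: banach
proof
  fix X :: "nat \<Rightarrow> l2"
  assume X: "Cauchy X"
  have "Cauchy (\<lambda>k. coord (X k) i)" for i
    by (rule bounded_linear.Cauchy[OF bounded_linear_coord X])
  then have "\<exists>a. (\<lambda>k. coord (X k) i) \<longlonglongrightarrow> a" for i
    using Cauchy_convergent convergent_def by blast
  then obtain a where a: "\<And>i. (\<lambda>k. coord (X k) i) \<longlonglongrightarrow> a i"
    by metis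
  have *: "\<exists>N. \<forall>k\<ge>N. summable (\<lambda>i. (coord (X k) i - a i)\<^sup>2) \<and> (\<Sum>i. (coord (X k) i - a i)\<^sup>2) \<le> e\<^sup>2"
    if "e > 0" for e
  proof -
    obtain N where N: "\<And>k l. k \<ge> N \<Longrightarrow> l \<ge> N \<Longrightarrow> norm (X k - X l) < e"
      using CauchyD[OF X \<open>e > 0\<close>] by blast
    have bound: "(\<Sum>i<n. (coord (X k) i - a i)\<^sup>2) \<le> e\<^sup>2" if "k \<ge> N" for k n
    proof (rule LIMSEQ_le_const2)
      show "(\<lambda>l. \<Sum>i<n. (coord (X k) i - coord (X l) i)\<^sup>2) \<longlonglongrightarrow> (\<Sum>i<n. (coord (X k) i - a i)\<^sup>2)"
        by (intro tendsto_intros a)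
      have "(\<Sum>i<n. (coord (X k) i - coord (X l) i)\<^sup>2) \<le> e\<^sup>2" if "l \<ge> N" for l
      proof -
        have "(\<Sum>i<n. coord (X k - X l) i * coord (X k - X l) i) \<le> inner (X k - X l) (X k - X l)"
          unfolding inner_l2_def by (rule sum_le_suminf) (auto simp del: coord_minus intro: summable_coord_mult)
        also have "\<dots> \<le> e\<^sup>2"
          using N[OF \<open>k \<ge> N\<close> that] by (simp add: dot_square_norm power_mono)
        finally show ?thesis
          by (simp add: power2_eq_square)
      qed
      then show "\<exists>M. \<forall>l\<ge>M. (\<Sum>i<n. (coord (X k) i - coord (X l) i)\<^sup>2) \<le> e\<^sup>2"
        by blast
    qed
    have s: "summable (\<lambda>i. (coord (X k) i - a i)\<^sup>2)" if "k \<ge> N" for k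
      using bound[OF that] by (intro summableI_nonneg_bounded) auto
    show ?thesis
      using s bound by (intro exI[of _ N]) (auto intro: suminf_le_const)
  qed
  obtain N where "summable (\<lambda>i. (coord (X N) i - a i)\<^sup>2)"
    using *[of 1] by auto
  moreover have "summable (\<lambda>i. (coord (X N) i)\<^sup>2)"
    using coord by auto
  ultimately have "summable (\<lambda>i. 2 * (coord (X N) i - a i)\<^sup>2 + 2 * (coord (X N) i)\<^sup>2)"
    by (intro summable_add summable_mult)
  then have "summable (\<lambda>i. (a i)\<^sup>2)"
  proof (rule summable_comparison_test')
    fix i :: nat
    have "0 \<le> (2 * coord (X N) i - a i)\<^sup>2"
      by simp
    then show "norm ((a i)\<^sup>2) \<le> 2 * (coord (X N) i - a i)\<^sup>2 + 2 * (coord (X N) i)\<^sup>2"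
      by (simp add: power2_eq_square algebra_simps)
  qed
  then have ca: "coord (mk_l2 a) = a"
    by (simp add: mk_l2_inverse)
  have "X \<longlonglongrightarrow> mk_l2 a"
  proof (rule LIMSEQ_I)
    fix r :: real assume "r > 0"
    then obtain N where N: "\<And>k. k \<ge> N \<Longrightarrow> (\<Sum>i. (coord (X k) i - a i)\<^sup>2) \<le> (r/2)\<^sup>2"
      using *[of "r/2"] by auto
    have "norm (X k - mk_l2 a) < r" if "k \<ge> N" for k
    proof -
      have "(norm (X k - mk_l2 a))\<^sup>2 = (\<Sum>i. (coord (X k) i - a i)\<^sup>2)"
        unfolding power2_norm_eq_inner by (simp add: inner_l2_def ca power2_eq_square)
      then have "(norm (X k - mk_l2 a))\<^sup>2 \<le> (r/2)\<^sup>2"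
        using N[OF that] by simp
      then have "norm (X k - mk_l2 a) \<le> r / 2"
        by (rule power2_le_imp_le) (use \<open>r > 0\<close> in simp)
      then show ?thesis using \<open>r > 0\<close> by simp
    qed
    then show "\<exists>N. \<forall>k\<ge>N. norm (X k - mk_l2 a) < r" by blast
  qed
  then show "convergent X"
    by (auto simp: convergent_def)
qed

definition unit_l2 :: "nat \<Rightarrow> l2" where
  "unit_l2 i = mk_l2 (\<lambda>j. if j = i then 1 else 0)"

lemma coord_unit_l2: "coord (unit_l2 i) j = (if j = i then 1 else 0)"
proof -
  have "summable (\<lambda>j. (if j = i then 1 else 0 :: real)\<^sup>2)"
    by (rule summable_finite[of "{i}"]) auto
  then show ?thesis
    by (simp add: unit_l2_def mk_l2_inverse)
qed

lemma coord_sum: "coord (\<Sum>i\<in>A. f i) j = (\<Sum>i\<in>A. coord (f i) j)"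
  by (induction A rule: infinite_finite_induct) auto

definition trunc :: "nat \<Rightarrow> l2 \<Rightarrow> l2" where
  "trunc d x = (\<Sum>i<d. coord x i *\<^sub>R unit_l2 i)"

lemma coord_trunc: "coord (trunc d x) j = (if j < d then coord x j else 0)"
  by (simp add: trunc_def coord_sum coord_unit_l2 if_distrib cong: if_cong)

lemma trunc_in_Rd: "trunc d x \<in> Rd d"
  by (simp add: Rd_def coord_trunc)

lemma trunc_id: "x \<in> Rd d \<Longrightarrow> trunc d x = x"
  by (auto intro!: l2_eqI simp: coord_trunc Rd_def)

lemma bounded_linear_trunc: "bounded_linear (trunc d)"
  unfolding trunc_def
  by (intro bounded_linear_sum bounded_linear_scaleR_const bounded_linear_coord)

lemma riesz_Rd:
  assumes "bounded_linear (f :: l2 \<Rightarrow> real)"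
  shows "\<exists>g\<in>Rd d. \<forall>h\<in>Rd d. f h = inner g h"
proof (intro bexI ballI)
  interpret bounded_linear f by fact
  let ?g = "\<Sum>i<d. f (unit_l2 i) *\<^sub>R unit_l2 i"
  have c: "coord ?g j = (if j < d then f (unit_l2 j) else 0)" for j
    by (simp add: coord_sum coord_unit_l2 if_distrib cong: if_cong)
  show g: "?g \<in> Rd d"
    by (simp add: Rd_def c)
  fix h assume "h \<in> Rd d"
  then have "f h = f (trunc d h)" by (simp add: trunc_id)
  also have "\<dots> = (\<Sum>i<d. coord h i * f (unit_l2 i))"
    by (simp add: trunc_def sum scaleR)
  also have "\<dots> = inner ?g h"
    by (simp add: inner_Rd[OF g] c mult.commute)
  finally show "f h = inner ?g h" .
qed

section \<open>Global solutions of Lipschitz differential equations\<close>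

text \<open>
  Instead of solving on short intervals and gluing, the fixed point problem is posed for
  \<open>\<phi>(s) = exp(-l s) z(s)\<close> on all of \<open>[0, T]\<close>. The weight makes the Picard map a contraction with
  factor \<open>L / l < 1 / 2\<close> regardless of \<open>T\<close>.
\<close>

lemma lipschitz_ode_exists:
  fixes F :: "'b::banach \<Rightarrow> 'b"
  assumes lip: "L-lipschitz_on UNIV F" and T: "0 \<le> T"
  shows "\<exists>z. z 0 = z0 \<and> (\<forall>s\<in>{0..T}. (z has_vector_derivative F (z s)) (at s within {0..T}))"
proof -
  define l where "l = 2 * L + 1"
  have L: "L \<ge> 0" using lip by (rule lipschitz_on_nonneg)
  then have l: "l > 0" by (simp add: l_def)
  have contF: "continuous_on UNIV F"
    using lip by (rule lipschitz_on_continuous_on)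
  define g where "g \<phi> r = F (exp (l * r) *\<^sub>R \<phi> r)" for \<phi> :: "real \<Rightarrow> 'b" and r
  define \<Gamma> where "\<Gamma> \<phi> s = exp (- l * s) *\<^sub>R (z0 + integral {0..s} (g \<phi>))" for \<phi> :: "real \<Rightarrow> 'b" and s
  \<comment> \<open>Freezing functions outside the interval turns them into bounded continuous functions on the line,
    which form a complete space.\<close>
  define c where "c s = max 0 (min T s)" for s
  have c: "c s \<in> {0..T}" "continuous_on UNIV c" "s \<in> {0..T} \<Longrightarrow> c s = s" for s
    using T unfolding c_def by (auto intro!: continuous_intros)
  have contg: "continuous_on S (g (apply_bcontfun \<phi>))" for \<phi> S
    unfolding g_def
    by (rule continuous_on_compose2[OF contF]) (auto intro!: continuous_intros)
  have cont\<Gamma>: "continuous_on {0..T} (\<Gamma> (apply_bcontfun \<phi>))" for \<phi>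
    unfolding \<Gamma>_def by (intro continuous_intros indefinite_integral_continuous_1 integrable_continuous_real contg)
  have bc: "(\<lambda>s. \<Gamma> (apply_bcontfun \<phi>) (c s)) \<in> bcontfun" for \<phi>
  proof -
    have "continuous_on UNIV (\<lambda>s. \<Gamma> (apply_bcontfun \<phi>) (c s))"
      by (rule continuous_on_compose2[OF cont\<Gamma> c(2)]) (use c in auto)
    moreover have "bounded (\<Gamma> (apply_bcontfun \<phi>) ` {0..T})"
      by (intro compact_imp_bounded compact_continuous_image cont\<Gamma>) auto
    then have "bounded (range (\<lambda>s. \<Gamma> (apply_bcontfun \<phi>) (c s)))"
      by (rule bounded_subset) (use c in auto)
    ultimately show ?thesis by (simp add: bcontfun_def)
  qed
  define \<Psi> where "\<Psi> \<phi> = Bcontfun (\<lambda>s. \<Gamma> (apply_bcontfun \<phi>) (c s))" for \<phi>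
  have \<Psi>: "apply_bcontfun (\<Psi> \<phi>) s = \<Gamma> (apply_bcontfun \<phi>) (c s)" for \<phi> s
    unfolding \<Psi>_def using Bcontfun_inverse[OF bc] by simp
  have contr: "dist (\<Psi> \<phi>) (\<Psi> \<psi>) \<le> (1/2) * dist \<phi> \<psi>" for \<phi> \<psi>
  proof (rule dist_bound)
    fix s
    define t where "t = c s"
    have t: "0 \<le> t" using c(1)[of s] by (simp add: t_def)
    let ?d = "dist \<phi> \<psi>"
    have int: "g (apply_bcontfun \<phi>) integrable_on {0..t}" for \<phi>
      by (intro integrable_continuous_real contg)
    have e: "((\<lambda>r. L * ?d * exp (l * r)) has_integral L * ?d * exp (l * t) / l - L * ?d * exp (l * 0) / l) {0..t}"
      using l by (intro fundamental_theorem_of_calculus t)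
        (auto intro!: derivative_eq_intros simp: has_real_derivative_iff_has_vector_derivative[symmetric])
    have "norm (integral {0..t} (\<lambda>r. g \<phi> r - g \<psi> r)) \<le> integral {0..t} (\<lambda>r. L * ?d * exp (l * r))"
    proof (rule integral_norm_bound_integral)
      fix r
      have "norm (g \<phi> r - g \<psi> r) \<le> L * dist (exp (l * r) *\<^sub>R \<phi> r) (exp (l * r) *\<^sub>R \<psi> r)"
        unfolding g_def dist_norm[symmetric] by (rule lipschitz_onD[OF lip]) auto
      also have "\<dots> = L * exp (l * r) * dist (\<phi> r) (\<psi> r)"
        by (simp add: dist_norm scaleR_diff_right[symmetric])
      also have "\<dots> \<le> L * exp (l * r) * ?d"
        using L by (intro mult_left_mono dist_bounded) auto
      finally show "norm (g \<phi> r - g \<psi> r) \<le> L * ?d * exp (l * r)" by (simp add: mult_ac)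
    qed (use e int in \<open>auto intro!: integrable_diff\<close>)
    also have "\<dots> \<le> L * ?d * exp (l * t) / l"
      using l L integral_unique[OF e] by simp
    also have "\<dots> \<le> ?d * exp (l * t) / 2"
    proof -
      have "2 * L * (?d * exp (l * t)) \<le> l * (?d * exp (l * t))"
        by (intro mult_right_mono) (auto simp: l_def)
      then show ?thesis using l by (simp add: field_simps)
    qed
    finally have "norm (integral {0..t} (g \<phi>) - integral {0..t} (g \<psi>)) \<le> ?d * exp (l * t) / 2"
      using int by (simp add: integral_diff)
    then have "exp (- l * t) * norm (integral {0..t} (g \<phi>) - integral {0..t} (g \<psi>)) \<le> exp (- l * t) * (?d * exp (l * t) / 2)"
      by (intro mult_left_mono) auto
    also have "\<dots> = 1 / 2 * ?d"
      by (simp add: exp_minus field_simps)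
    finally show "dist (\<Psi> \<phi> s) (\<Psi> \<psi> s) \<le> 1 / 2 * ?d"
      unfolding \<Psi> \<Gamma>_def t_def[symmetric] dist_norm
      by (simp add: scaleR_diff_right[symmetric])
  qed
  obtain \<phi> where \<phi>: "\<Psi> \<phi> = \<phi>"
    using banach_fix_type[of "1/2" \<Psi>] contr by auto
  define z where "z s = z0 + integral {0..s} (g \<phi>)" for s
  have z: "exp (l * s) *\<^sub>R \<phi> s = z s" if "s \<in> {0..T}" for s
    using \<Psi>[of \<phi> s] c(3)[OF that] by (simp add: \<phi> \<Gamma>_def z_def exp_minus)
  show ?thesis
  proof (intro exI[of _ z] conjI ballI)
    show "z 0 = z0" by (simp add: z_def)
    fix s assume s: "s \<in> {0..T}"
    have "(z has_vector_derivative g \<phi> s) (at s within {0..T})"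
      unfolding z_def
      using integral_has_vector_derivative[OF contg s] 
      by (auto intro!: derivative_eq_intros)
    then show "(z has_vector_derivative F (z s)) (at s within {0..T})"
      by (simp add: g_def z[OF s])
  qed
qed

section \<open>Growth estimates, expansions and perturbations\<close>

lemma nondecreasing_on_interval:
  fixes f :: "real \<Rightarrow> real"
  assumes f: "\<And>s. s \<in> {a..b} \<Longrightarrow> (f has_real_derivative f' s) (at s within {a..b})"
    and "\<And>s. s \<in> {a..b} \<Longrightarrow> f' s \<ge> 0" and "a \<le> b"
  shows "f a \<le> f b"
proof (cases "a < b")
  case True
  have c: "continuous_on {a..b} f"
    using f by (meson DERIV_continuous continuous_on_eq_continuous_within)
  have "\<exists>y. (f has_real_derivative y) (at x) \<and> 0 \<le> y" if "a < x" "x < b" for x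
    using f[of x] assms(2)[of x] that at_within_Icc_at[of a x b] by auto
  then show ?thesis
    using DERIV_nonneg_imp_increasing_open[OF \<open>a \<le> b\<close> _ c] by blast
qed (use assms in simp)

lemma increment_bound:
  fixes f :: "real \<Rightarrow> 'a::real_normed_vector"
  assumes "a \<le> b" "continuous_on {a..b} f"
    and "\<And>s. a < s \<Longrightarrow> s < b \<Longrightarrow> (f has_vector_derivative f' s) (at s)"
    and "\<And>s. a < s \<Longrightarrow> s < b \<Longrightarrow> norm (f' s) \<le> B"
  shows "norm (f b - f a) \<le> B * (b - a)"
proof (cases "a < b")
  case True
  have phi: "continuous_on {a..b} (\<lambda>s. B * s)" "((\<lambda>s. B * s) has_vector_derivative B) (at s)" for s
    by (auto intro!: continuous_intros derivative_eq_intros)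
  have "norm (f b - f a) \<le> B * b - B * a"
    by (rule differentiable_bound_general[OF True assms(2) phi(1) assms(3) phi(2) assms(4)])
  then show ?thesis by (simp add: right_diff_distrib)
qed (use assms in simp)

lemma increment_bound_within:
  fixes f :: "real \<Rightarrow> 'a::real_normed_vector"
  assumes f: "\<And>s. s \<in> {0..T} \<Longrightarrow> (f has_vector_derivative f' s) (at s within {0..T})"
    and B: "\<And>s. s \<in> {0..T} \<Longrightarrow> norm (f' s) \<le> B" and "a \<in> {0..T}" "b \<in> {0..T}"
  shows "norm (f b - f a) \<le> B * \<bar>b - a\<bar>"
proof -
  have c: "continuous_on {0..T} f"
    using f by (rule continuous_on_vector_derivative)
  have *: "norm (f b - f a) \<le> B * (b - a)" if "a \<le> b" "a \<in> {0..T}" "b \<in> {0..T}" for a b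
  proof (rule increment_bound[OF that(1), of f f'])
    show "continuous_on {a..b} f" by (rule continuous_on_subset[OF c]) (use that in auto)
    show "(f has_vector_derivative f' s) (at s)" "norm (f' s) \<le> B" if "a < s" "s < b" for s
      using f[of s] B[of s] that \<open>a \<in> _\<close> \<open>b \<in> _\<close> at_within_Icc_at[of 0 s T] by auto
  qed
  show ?thesis
  proof (cases "a \<le> b")
    case True then show ?thesis using *[of a b] assms by simp
  next
    case False then show ?thesis using *[of b a] assms by (simp add: norm_minus_commute)
  qed
qed

text \<open>
  Gronwall's inequality: \<open>exp(-2 L s) |z(s)|\<^sup>2\<close> is nonincreasing.
\<close>

lemma norm_exp_growth:
  fixes z :: "real \<Rightarrow> 'a::real_inner"
  assumes z: "\<And>s. s \<in> {0..T} \<Longrightarrow> (z has_vector_derivative z' s) (at s within {0..T})"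
    and le: "\<And>s. s \<in> {0..T} \<Longrightarrow> norm (z' s) \<le> L * norm (z s)" and s: "s \<in> {0..T}"
  shows "norm (z s) \<le> exp (L * s) * norm (z 0)"
proof -
  define f where "f s = - (exp (- 2 * L * s) * inner (z s) (z s))" for s
  define f' where "f' s = - (exp (- 2 * L * s) * (2 * inner (z s) (z' s) - 2 * L * inner (z s) (z s)))" for s
  have d: "(f has_real_derivative f' r) (at r within {0..s})" if "r \<in> {0..s}" for r
  proof -
    have "((\<lambda>r. inner (z r) (z r)) has_real_derivative 2 * inner (z r) (z' r)) (at r within {0..s})"
      using has_vector_derivative_within_subset[OF z, of r "{0..s}"] that s
      unfolding has_vector_derivative_def has_field_derivative_def
      by (auto intro!: derivative_eq_intros simp: inner_commute algebra_simps)
    then show ?thesis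
      unfolding f_def f'_def by (auto intro!: derivative_eq_intros simp: algebra_simps)
  qed
  have n: "f' r \<ge> 0" if "r \<in> {0..s}" for r
  proof -
    have "inner (z r) (z' r) \<le> norm (z r) * norm (z' r)" by (rule norm_cauchy_schwarz)
    also have "\<dots> \<le> norm (z r) * (L * norm (z r))" using that s by (intro mult_left_mono le) auto
    also have "\<dots> = L * inner (z r) (z r)" by (simp add: dot_square_norm power2_eq_square)
    finally show ?thesis unfolding f'_def by (simp add: mult_nonneg_nonpos)
  qed
  have "f 0 \<le> f s"
    by (rule nondecreasing_on_interval[OF d n]) (use s in auto)
  then have "exp (- 2 * L * s) * (norm (z s))\<^sup>2 \<le> (norm (z 0))\<^sup>2"
    by (simp add: f_def dot_square_norm)
  then have "exp (2 * L * s) * (exp (- 2 * L * s) * (norm (z s))\<^sup>2) \<le> exp (2 * L * s) * (norm (z 0))\<^sup>2"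
    by (intro mult_left_mono) auto
  also have "exp (2 * L * s) * (exp (- 2 * L * s) * (norm (z s))\<^sup>2) = (norm (z s))\<^sup>2"
    by (simp add: exp_minus)
  also have "exp (2 * L * s) * (norm (z 0))\<^sup>2 = (exp (L * s) * norm (z 0))\<^sup>2"
    using exp_double[of "L * s"] by (simp add: power_mult_distrib mult.assoc)
  finally show ?thesis
    by (rule power2_le_imp_le) simp
qed

text \<open>
  A Gronwall argument for functions that are merely continuous: on an interval of length
  \<open>\<delta>\<close> with \<open>C \<delta> \<le> 1 / 2\<close> that starts at a zero of \<open>D\<close>, the maximum of \<open>|D|\<close> is at most half of itself.
\<close>

lemma vanishing_by_small_increments:
  fixes D :: "real \<Rightarrow> 'a::real_normed_vector"
  assumes c: "continuous_on {0..T} D" and D0: "D 0 = 0" and C: "0 \<le> C"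
    and incr: "\<And>a b M. 0 \<le> a \<Longrightarrow> a \<le> b \<Longrightarrow> b \<le> T \<Longrightarrow> (\<And>r. r \<in> {a..b} \<Longrightarrow> norm (D r) \<le> M) \<Longrightarrow>
       norm (D b - D a) \<le> C * M * (b - a)"
    and s: "s \<in> {0..T}"
  shows "D s = 0"
proof -
  define \<delta> where "\<delta> = 1 / (2 * C + 2)"
  have \<delta>: "\<delta> > 0" "C * \<delta> \<le> 1 / 2" using C by (auto simp: \<delta>_def field_simps)
  have "\<forall>s\<in>{0..T}. s \<le> real n * \<delta> \<longrightarrow> D s = 0" for n
  proof (induction n)
    case 0 then show ?case using D0 by auto
  next
    case (Suc n)
    show ?case
    proof (intro ballI impI)
      fix s assume s: "s \<in> {0..T}" "s \<le> real (Suc n) * \<delta>"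
      define a where "a = real n * \<delta>"
      show "D s = 0"
      proof (cases "s \<le> a")
        case True then show ?thesis using Suc s by (simp add: a_def)
      next
        case False
        have a: "0 \<le> a" "D a = 0" using Suc False s \<delta> by (auto simp: a_def)
        have "continuous_on {a..s} (\<lambda>r. norm (D r))"
          by (intro continuous_on_norm continuous_on_subset[OF c]) (use a s in auto)
        then obtain r where r: "r \<in> {a..s}" "\<And>r'. r' \<in> {a..s} \<Longrightarrow> norm (D r') \<le> norm (D r)"
          using continuous_attains_sup[of "{a..s}" "\<lambda>r. norm (D r)"] False by auto
        have "norm (D r - D a) \<le> C * norm (D r) * (r - a)"
          by (rule incr) (use r a s in auto)
        also have "\<dots> \<le> C * norm (D r) * \<delta>"
          using r s C by (intro mult_left_mono) (auto simp: a_def algebra_simps)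
        also have "\<dots> \<le> 1 / 2 * norm (D r)"
          using mult_right_mono[OF \<delta>(2), of "norm (D r)"] by (simp add: mult_ac)
        finally have "norm (D r) = 0" using a by simp
        then show ?thesis using r(2)[of s] False by simp
      qed
    qed
  qed
  moreover obtain n where "s / \<delta> \<le> real n"
    using real_arch_simple by blast
  ultimately show ?thesis
    using s \<delta> by (auto simp: field_simps)
qed

lemma taylor_lipschitz_gradient:
  fixes f :: "'a::real_inner \<Rightarrow> real"
  assumes S: "convex S" and f: "\<And>x. x \<in> S \<Longrightarrow> (f has_derivative (\<lambda>h. inner (g x) h)) (at x within S)"
    and g: "L-lipschitz_on S g" and xy: "x \<in> S" "y \<in> S"
  shows "\<bar>f y - f x - inner (g x) (y - x)\<bar> \<le> L * (norm (y - x))\<^sup>2"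
proof -
  have sub: "closed_segment x y \<subseteq> S" using S xy by (simp add: closed_segment_subset)
  have on: "onorm (inner (g u) - inner (g x)) \<le> L * norm (y - x)" if u: "u \<in> closed_segment x y" for u
  proof (rule onorm_bound)
    fix h :: 'a
    have "norm (u - x) \<le> norm (y - x)"
      using segment_bound1[OF u] .
    moreover have "norm (g u - g x) \<le> L * norm (u - x)"
      by (rule lipschitz_on_normD[OF g]) (use u sub xy in auto)
    ultimately have "norm (g u - g x) \<le> L * norm (y - x)"
      using lipschitz_on_nonneg[OF g] by (meson mult_left_mono order_trans)
    then have "norm (g u - g x) * norm h \<le> L * norm (y - x) * norm h"
      by (rule mult_right_mono) simp
    then show "norm ((inner (g u) - inner (g x)) h) \<le> L * norm (y - x) * norm h"
      using Cauchy_Schwarz_ineq2[of "g u - g x" h] by (simp add: inner_diff_left)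
  qed (use lipschitz_on_nonneg[OF g] in simp)
  have seg: "x + t *\<^sub>R (y - x) \<in> closed_segment x y" if "t \<in> {0..1}" for t
    using that by (auto simp: in_segment algebra_simps intro!: exI[of _ t])
  have der: "(f has_derivative inner (g u)) (at u within closed_segment x y)" if "u \<in> closed_segment x y" for u
    using has_derivative_subset[OF f sub] that sub by auto
  have "norm (f y - f x - inner (g x) (y - x)) \<le> norm (y - x) * (L * norm (y - x))"
    by (rule differentiable_bound_linearization[OF seg der on]) simp_all
  then show ?thesis by (simp add: power2_eq_square mult_ac)
qed

text \<open>
  Both partial derivatives of the solution are obtained from this: a function that agrees with a
  differentiable model up to a quadratic error has the derivative of the model.
\<close>

lemma has_derivative_quadratic_perturbation:
  fixes f :: "'a::real_normed_vector \<Rightarrow> 'b::real_normed_vector"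
  assumes a: "(a has_derivative A) (at x within S)" and "x \<in> S"
    and C: "\<And>y. y \<in> S \<Longrightarrow> norm (f y - a y) \<le> C * (norm (y - x))\<^sup>2"
  shows "(f has_derivative A) (at x within S)"
proof -
  have fx: "f x = a x" using C[OF \<open>x \<in> S\<close>] by simp
  have "((\<lambda>y. f y - a y) has_derivative (\<lambda>_. 0)) (at x within S)"
  proof (rule has_derivativeI_sandwich[of 1 _ _ _ _ "\<lambda>y. C * norm (y - x)"])
    fix y assume "y \<in> S" "y \<noteq> x"
    then show "norm (f y - a y - (f x - a x) - 0) / norm (y - x) \<le> C * norm (y - x)"
      using C[of y] by (simp add: fx divide_le_eq power2_eq_square mult.assoc)
  next
    have "((\<lambda>y. C * norm (y - x)) \<longlongrightarrow> C * norm (x - x)) (at x within S)"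
      by (intro tendsto_intros)
    then show "((\<lambda>y. C * norm (y - x)) \<longlongrightarrow> 0) (at x within S)" by simp
  qed auto
  from has_derivative_add[OF this a] show ?thesis by simp
qed

lemma locally_lipschitz_on_imp_continuous_on:
  assumes "locally_lipschitz_on S f"
  shows "continuous_on S f"
  unfolding continuous_on_eq_continuous_within
proof
  fix z assume z: "z \<in> S"
  then obtain r L where r: "r > 0" "L-lipschitz_on (cball z r \<inter> S) f"
    using assms by (auto simp: locally_lipschitz_on_def)
  then have "continuous (at z within cball z r \<inter> S) f"
    using lipschitz_on_continuous_on[OF r(2)] z by (simp add: continuous_on_eq_continuous_within)
  moreover have "at z within cball z r \<inter> S = at z within S"
    by (rule at_within_nhd[of z "ball z r"]) (use r in auto)
  ultimately show "continuous (at z within S) f"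
    unfolding continuous_within by simp
qed

lemma locally_lipschitz_on_cong:
  assumes "locally_lipschitz_on S g" and "\<And>x. x \<in> S \<Longrightarrow> f x = g x"
  shows "locally_lipschitz_on S f"
  using assms unfolding locally_lipschitz_on_def lipschitz_on_def by auto

lemma locally_lipschitz_on_compose:
  assumes f: "locally_lipschitz_on S f" and g: "locally_lipschitz_on R g" and "f ` S \<subseteq> R"
  shows "locally_lipschitz_on S (\<lambda>x. g (f x))"
  unfolding locally_lipschitz_on_def
proof
  fix z assume z: "z \<in> S"
  obtain r L where r: "r > 0" "L-lipschitz_on (cball z r \<inter> S) f"
    using f z by (auto simp: locally_lipschitz_on_def)
  obtain q M where q: "q > 0" "M-lipschitz_on (cball (f z) q \<inter> R) g"
    using g z assms(3) unfolding locally_lipschitz_on_def by blast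
  have L: "L \<ge> 0" using r(2) by (rule lipschitz_on_nonneg)
  \<comment> \<open>The radius is small enough for \<open>f\<close> to map the ball into the one around \<open>f z\<close>; \<open>L + 1\<close> allows \<open>L = 0\<close>.\<close>
  define p where "p = min r (q / (L + 1))"
  have p: "p > 0" using r q L by (simp add: p_def)
  have "f ` (cball z p \<inter> S) \<subseteq> cball (f z) q \<inter> R"
  proof safe
    fix x assume x: "x \<in> cball z p" "x \<in> S"
    have "dist (f z) (f x) \<le> L * dist z x"
      by (rule lipschitz_onD[OF r(2)]) (use x z r in \<open>auto simp: p_def\<close>)
    also have "\<dots> \<le> (L + 1) * (q / (L + 1))"
      using L x by (intro mult_mono) (auto simp: p_def)
    finally show "f x \<in> cball (f z) q" using L by simp
    show "f x \<in> R" using x assms(3) by auto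
  qed
  moreover have "L-lipschitz_on (cball z p \<inter> S) f"
    by (rule lipschitz_on_subset[OF r(2)]) (auto simp: p_def)
  ultimately have "(M * L)-lipschitz_on (cball z p \<inter> S) (\<lambda>x. g (f x))"
    using lipschitz_on_compose2 lipschitz_on_subset[OF q(2)] by blast
  then show "\<exists>r>0. \<exists>L. L-lipschitz_on (cball z r \<inter> S) (\<lambda>x. g (f x))"
    using p by blast
qed

lemma locally_lipschitz_onI_bounded:
  fixes f :: "'a::real_normed_vector \<Rightarrow> 'b::metric_space"
  assumes "\<And>R. R > 0 \<Longrightarrow> \<exists>L. L-lipschitz_on (S \<inter> cball 0 R) f"
  shows "locally_lipschitz_on S f"
  unfolding locally_lipschitz_on_def
proof
  fix z :: 'a
  have "norm z + 1 > 0"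
    by (smt (verit) norm_ge_zero)
  then obtain L where "L-lipschitz_on (S \<inter> cball 0 (norm z + 1)) f"
    using assms by blast
  moreover have "cball z 1 \<inter> S \<subseteq> S \<inter> cball 0 (norm z + 1)"
    using norm_triangle_ineq4 by (auto simp: dist_norm) (smt (verit) norm_minus_commute norm_triangle_ineq2)
  ultimately show "\<exists>r>0. \<exists>L. L-lipschitz_on (cball z r \<inter> S) f"
    using lipschitz_on_subset zero_less_one by metis
qed

lemma locally_lipschitz_on_lipschitz_gradient:
  fixes f :: "'a::real_inner \<Rightarrow> real"
  assumes S: "convex S" "0 \<in> S" and f: "\<And>x. x \<in> S \<Longrightarrow> (f has_derivative (\<lambda>h. inner (g x) h)) (at x within S)"
    and g: "L-lipschitz_on S g"
  shows "locally_lipschitz_on S f"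
proof (rule locally_lipschitz_onI_bounded)
  fix R :: real assume R: "R > 0"
  have L: "L \<ge> 0" using g by (rule lipschitz_on_nonneg)
  let ?C = "norm (g 0) + L * R + L * (2 * R)"
  have "?C-lipschitz_on (S \<inter> cball 0 R) f"
  proof (rule lipschitz_onI)
    fix x y assume x: "x \<in> S \<inter> cball 0 R" and y: "y \<in> S \<inter> cball 0 R"
    have "\<bar>f y - f x - inner (g x) (y - x)\<bar> \<le> L * norm (y - x) * norm (y - x)"
      using taylor_lipschitz_gradient[OF S(1) f g, of x y] x y by (simp add: power2_eq_square mult.assoc)
    also have "\<dots> \<le> L * (2 * R) * norm (y - x)"
      using x y L norm_triangle_ineq4[of y x] by (intro mult_right_mono mult_left_mono) auto
    finally have 1: "\<bar>f y - f x - inner (g x) (y - x)\<bar> \<le> L * (2 * R) * norm (y - x)" .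
    have "norm (g x) \<le> norm (g 0) + norm (g x - g 0)"
      by (metis add_diff_cancel_left' diff_add_cancel norm_triangle_ineq)
    also have "norm (g x - g 0) \<le> L * norm (x - 0)"
      by (rule lipschitz_on_normD[OF g]) (use x S in auto)
    also have "\<dots> \<le> L * R" using x L by (intro mult_left_mono) auto
    finally have "norm (g x) * norm (y - x) \<le> (norm (g 0) + L * R) * norm (y - x)"
      by (intro mult_right_mono) auto
    moreover have "\<bar>inner (g x) (y - x)\<bar> \<le> norm (g x) * norm (y - x)"
      by (rule Cauchy_Schwarz_ineq2)
    ultimately show "dist (f x) (f y) \<le> ?C * dist x y"
      using 1 unfolding dist_norm real_norm_def norm_minus_commute[of x y] distrib_right[of _ "L * (2 * R)"]
      by linarith
  qed (use L R in auto)
  then show "\<exists>L. L-lipschitz_on (S \<inter> cball 0 R) f" by blast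
qed

text \<open>
  Comparing points of a compact set with arbitrary nearby points of \<open>S\<close>, so that a whole
  neighbourhood of a curve is covered with one constant although \<open>S\<close> itself is not compact.
\<close>

lemma locally_lipschitz_on_compact_uniform:
  assumes f: "locally_lipschitz_on S f" and K: "compact K" "K \<subseteq> S"
  obtains r N where "r > 0" "N \<ge> 0"
    "\<And>z x. z \<in> K \<Longrightarrow> x \<in> S \<Longrightarrow> dist z x < r \<Longrightarrow> dist (f z) (f x) \<le> N * dist z x"
proof -
  obtain r L where rL: "\<And>z. z \<in> S \<Longrightarrow> r z > 0 \<and> (L z)-lipschitz_on (cball z (r z) \<inter> S) f"
    using f unfolding locally_lipschitz_on_def by metis
  have "K \<subseteq> (\<Union>z\<in>K. ball z (r z / 2))"
    using rL K by force
  then obtain A where A: "A \<subseteq> K" "finite A" "K \<subseteq> (\<Union>z\<in>A. ball z (r z / 2))"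
    using compactE_image[OF K(1), of K "\<lambda>z. ball z (r z / 2)"] by (metis open_ball)
  show ?thesis
  proof (cases "A = {}")
    case True
    then show ?thesis using A that[of 1 0] by auto
  next
    case False
    define q where "q = Min ((\<lambda>z. r z / 2) ` A)"
    define N where "N = Max (L ` A)"
    have q: "q > 0" "\<And>z. z \<in> A \<Longrightarrow> q \<le> r z / 2"
    proof -
      show "q > 0" using False A rL K unfolding q_def by (subst Min_gr_iff) auto
      show "q \<le> r z / 2" if "z \<in> A" for z
        using that A unfolding q_def by (intro Min_le) auto
    qed
    have N: "\<And>z. z \<in> A \<Longrightarrow> L z \<le> N"
      using A unfolding N_def by auto
    obtain a where "a \<in> A" using False by auto
    then have N0: "N \<ge> 0"
      using N[of a] rL[of a] A K lipschitz_on_nonneg by (meson order_trans subsetD)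
    show ?thesis
    proof (rule that[OF q(1) N0])
      fix z x assume zx: "z \<in> K" "x \<in> S" "dist z x < q"
      then obtain a where a: "a \<in> A" "dist a z < r a / 2" using A by auto
      have "dist a x \<le> dist a z + dist z x" by (rule dist_triangle)
      then have "dist a x \<le> r a" using a zx q(2)[OF a(1)] by linarith
      moreover have "dist a z \<le> r a" using a(2) zero_le_dist[of a z] by linarith
      moreover have La: "(L a)-lipschitz_on (cball a (r a) \<inter> S) f" using rL a A K by auto
      ultimately have "dist (f z) (f x) \<le> L a * dist z x"
        using lipschitz_onD[OF La, of z x] zx K by auto
      also have "\<dots> \<le> N * dist z x" using N[OF a(1)] by (intro mult_right_mono) auto
      finally show "dist (f z) (f x) \<le> N * dist z x" .
    qed
  qed
qed

text \<open>
  To solve \<open>g y = v\<close>, rewrite it as \<open>y = f\<^sup>-\<^sup>1(v - (g y - f y))\<close>; the right-hand side is a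
  contraction of the complete set \<open>V\<close>.
\<close>

lemma surjective_under_small_lipschitz_perturbation:
  fixes f g :: "'a::banach \<Rightarrow> 'a"
  assumes V: "closed V" "subspace V" and f: "f ` V = V" and g: "g ` V \<subseteq> V"
    and lower: "\<And>x y. x \<in> V \<Longrightarrow> y \<in> V \<Longrightarrow> norm (x - y) \<le> \<kappa> * norm (f x - f y)"
    and close: "\<And>x y. x \<in> V \<Longrightarrow> y \<in> V \<Longrightarrow> norm ((g x - f x) - (g y - f y)) \<le> c * norm (x - y)"
    and small: "\<kappa> * c < 1" "0 \<le> \<kappa>" "0 \<le> c"
  shows "g ` V = V"
proof (intro equalityI g subsetI)
  fix v assume v: "v \<in> V"
  define i where "i = inv_into V f"
  have i: "i w \<in> V \<and> f (i w) = w" if "w \<in> V" for w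
    using that f by (auto simp: i_def inv_into_into f_inv_into_f)
  define h where "h y = i (v - (g y - f y))" for y
  have arg: "v - (g y - f y) \<in> V" if "y \<in> V" for y
    using that v f g by (intro subspace_diff V) auto
  have "\<exists>!y\<in>V. h y = y"
  proof (rule Banach_fix[where c = "\<kappa> * c"])
    show "complete V" "V \<noteq> {}" "h ` V \<subseteq> V"
      using V v arg i by (auto simp: complete_eq_closed h_def)
    fix x y assume xy: "x \<in> V" "y \<in> V"
    have "norm (h x - h y) \<le> \<kappa> * norm (f (h x) - f (h y))"
      using xy arg i by (intro lower) (auto simp: h_def)
    also have "norm (f (h x) - f (h y)) = norm ((g x - f x) - (g y - f y))"
      using xy arg i norm_minus_cancel[of "(g x - f x) - (g y - f y)"] by (simp add: h_def algebra_simps)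
    also have "\<kappa> * \<dots> \<le> \<kappa> * (c * norm (x - y))"
      using xy small by (intro mult_left_mono close) auto
    finally show "dist (h x) (h y) \<le> \<kappa> * c * dist x y" by (simp add: dist_norm)
  qed (use small in auto)
  then obtain y where y: "y \<in> V" "h y = y" by blast
  then have "f y = v - (g y - f y)" using i[OF arg[OF y(1)]] by (simp add: h_def)
  then show "v \<in> g ` V" using y by (intro image_eqI[of _ _ y]) auto
qed

text \<open>
  The lower bound is uniform in time, so the length of the time steps that the preceding lemma
  permits does not shrink and finitely many of them reach \<open>s\<close>.
\<close>

lemma surjective_by_continuation:
  fixes X :: "real \<Rightarrow> 'a::banach \<Rightarrow> 'a"
  assumes V: "closed V" "subspace V" and X0: "X 0 ` V = V"
    and XV: "\<And>s. s \<in> {0..T} \<Longrightarrow> X s ` V \<subseteq> V"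
    and lower: "\<And>s x y. s \<in> {0..T} \<Longrightarrow> x \<in> V \<Longrightarrow> y \<in> V \<Longrightarrow> norm (x - y) \<le> \<kappa> * norm (X s x - X s y)"
    and close: "\<And>s t x y. s \<in> {0..T} \<Longrightarrow> t \<in> {0..T} \<Longrightarrow> x \<in> V \<Longrightarrow> y \<in> V \<Longrightarrow>
       norm ((X t x - X s x) - (X t y - X s y)) \<le> c * \<bar>t - s\<bar> * norm (x - y)"
    and nonneg: "0 \<le> \<kappa>" "0 \<le> c" and s: "s \<in> {0..T}"
  shows "X s ` V = V"
proof -
  define \<delta> where "\<delta> = 1 / (\<kappa> * c + 1)"
  have pos: "0 < \<kappa> * c + 1"
    using nonneg by (simp add: add_nonneg_pos)
  have \<delta>: "\<delta> > 0" "\<kappa> * (c * \<delta>) < 1" using pos by (auto simp: \<delta>_def field_simps)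
  have "\<forall>s\<in>{0..T}. s \<le> real n * \<delta> \<longrightarrow> X s ` V = V" for n
  proof (induction n)
    case 0 then show ?case using X0 by auto
  next
    case (Suc n)
    show ?case
    proof (intro ballI impI)
      fix t assume t: "t \<in> {0..T}" "t \<le> real (Suc n) * \<delta>"
      \<comment> \<open>The last time covered by the induction hypothesis that is not after \<open>t\<close>.\<close>
      define s where "s = min t (real n * \<delta>)"
      have s: "s \<in> {0..T}" "s \<le> real n * \<delta>" "\<bar>t - s\<bar> \<le> \<delta>"
        using t \<delta> by (auto simp: s_def algebra_simps)
      show "X t ` V = V"
      proof (rule surjective_under_small_lipschitz_perturbation[OF V, where f = "X s" and \<kappa> = \<kappa> and c = "c * \<delta>"])
        show "X s ` V = V" using Suc s by auto
        show "norm ((X t x - X s x) - (X t y - X s y)) \<le> c * \<delta> * norm (x - y)" if "x \<in> V" "y \<in> V" for x y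
          using close[OF s(1) t(1) that] s(3) nonneg
          by (meson mult_left_mono mult_right_mono norm_ge_zero order_trans)
      qed (use XV lower s t \<delta> nonneg in auto)
    qed
  qed
  moreover obtain n where "s / \<delta> \<le> real n"
    using real_arch_simple by blast
  ultimately show ?thesis
    using s \<delta> by (auto simp: field_simps)
qed

section \<open>Gradients and Hessians on a projected subspace\<close>

text \<open>
  The properties of a finite-dimensional subspace that the proof uses: a continuous projection,
  which extends vector fields from \<open>V\<close> to the ambient space, and Riesz representation, which
  supplies gradients in \<open>V\<close>.
\<close>

locale projected_subspace =
  fixes V :: "'a::{real_inner, banach} set" and \<pi> :: "'a \<Rightarrow> 'a"
  assumes subspace_V: "subspace V"
    and bounded_linear_\<pi>: "bounded_linear \<pi>"
    and \<pi>_in: "\<And>x. \<pi> x \<in> V"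
    and \<pi>_id: "\<And>x. x \<in> V \<Longrightarrow> \<pi> x = x"
    and riesz: "\<And>f. bounded_linear f \<Longrightarrow> \<exists>g\<in>V. \<forall>h\<in>V. f h = inner g h"
begin

lemma closed_V: "closed V"
proof -
  have "V = {x. \<pi> x = x}"
    using \<pi>_in \<pi>_id by (metis (mono_tags) Collect_cong Collect_mem_eq)
  moreover have "closed {x. \<pi> x = x}"
    by (intro closed_Collect_eq continuous_on_id bounded_linear.continuous_on[OF bounded_linear_\<pi>])
  ultimately show ?thesis by simp
qed

lemma convex_V: "convex V"
  by (rule subspace_imp_convex[OF subspace_V])

lemma V_intros [simp, intro]:
  "0 \<in> V" "x \<in> V \<Longrightarrow> y \<in> V \<Longrightarrow> x + y \<in> V" "x \<in> V \<Longrightarrow> y \<in> V \<Longrightarrow> x - y \<in> V"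
  "x \<in> V \<Longrightarrow> c *\<^sub>R x \<in> V" "x \<in> V \<Longrightarrow> - x \<in> V"
  using subspace_V by (auto simp: subspace_0 subspace_add subspace_diff subspace_scale subspace_neg)

lemma subspace_VV: "subspace (V \<times> V)"
  by (simp add: subspace_Times subspace_V)

lemma has_gradient:
  assumes "f differentiable (at x within V)" and x: "x \<in> V"
  shows "gradient V f x \<in> V" "(f has_derivative (\<lambda>h. inner (gradient V f x) h)) (at x within V)"
proof -
  obtain D where D: "(f has_derivative D) (at x within V)"
    using assms by (auto simp: differentiable_def)
  obtain g where g: "g \<in> V" "\<And>h. h \<in> V \<Longrightarrow> D h = inner g h"
    using riesz[OF has_derivative_bounded_linear[OF D]] by auto
  have "(f has_derivative (\<lambda>h. inner g h)) (at x within V)"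
    using D unfolding has_derivative_within
    by (auto simp: bounded_linear_inner_right g x elim!: Lim_transform_within[of _ _ _ _ 1])
  moreover from this have "gradient V f x = g"
    by (intro gradient_eqI subspace_V x g)
  ultimately show "gradient V f x \<in> V" "(f has_derivative (\<lambda>h. inner (gradient V f x) h)) (at x within V)"
    using g by auto
qed

lemma projected_subspace_Times:
  "projected_subspace (V \<times> V) (\<lambda>z. (\<pi> (fst z), \<pi> (snd z)))"
proof (rule projected_subspace.intro)
  show "subspace (V \<times> V)" by (rule subspace_VV)
  show "bounded_linear (\<lambda>z. (\<pi> (fst z), \<pi> (snd z)))"
    by (intro bounded_linear_Pair bounded_linear_compose[OF bounded_linear_\<pi>] bounded_linear_fst bounded_linear_snd)
  show "(\<pi> (fst x), \<pi> (snd x)) \<in> V \<times> V" for x by (simp add: \<pi>_in)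
  show "x \<in> V \<times> V \<Longrightarrow> (\<pi> (fst x), \<pi> (snd x)) = x" for x by (auto simp: \<pi>_id)
  fix f :: "'a \<times> 'a \<Rightarrow> real" assume f: "bounded_linear f"
  have "bounded_linear (\<lambda>h. f (h, 0))" "bounded_linear (\<lambda>h. f (0, h))"
    by (intro bounded_linear_compose[OF f] bounded_linear_Pair bounded_linear_ident bounded_linear_zero)+
  from riesz[OF this(1)] riesz[OF this(2)] obtain g k where g: "g \<in> V" "\<forall>h\<in>V. f (h, 0) = inner g h"
    and k: "k \<in> V" "\<forall>h\<in>V. f (0, h) = inner k h" by auto
  have "f (a, b) = inner (g, k) (a, b)" if "a \<in> V" "b \<in> V" for a b
  proof -
    have "f (a, b) = f ((a, 0) + (0, b))" by simp
    also have "\<dots> = f (a, 0) + f (0, b)"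
      using linear_add[OF bounded_linear.linear[OF f]] .
    finally show ?thesis using g k that by simp
  qed
  then show "\<exists>g\<in>V \<times> V. \<forall>h\<in>V \<times> V. f h = inner g h"
    using g k by (intro bexI[of _ "(g, k)"]) auto
qed

end

context projected_subspace
begin

lemma hessian_le_hessian_norm:
  assumes "bounded_hessian V f" and x: "x \<in> V" and h: "h \<in> V" "norm h \<le> 1"
  shows "norm (hessian V f x h) \<le> hessian_norm V f"
proof -
  let ?D = "{h \<in> V. norm h \<le> 1}"
  obtain B where B: "\<And>x h. x \<in> V \<Longrightarrow> h \<in> V \<Longrightarrow> norm h \<le> 1 \<Longrightarrow> norm (hessian V f x h) \<le> B"
    using assms(1) by (auto simp: bounded_hessian_def)
  have ne: "?D \<noteq> {}"
    using V_intros(1) norm_zero zero_le_one by (metis (mono_tags, lifting) empty_iff mem_Collect_eq)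
  have "norm (hessian V f x h) \<le> (SUP h\<in>?D. norm (hessian V f x h))"
    using B x h by (intro cSUP_upper) (auto intro!: bdd_aboveI2[where M = B])
  also have "\<dots> \<le> hessian_norm V f"
    unfolding hessian_norm_def
  proof (rule cSUP_upper[OF x])
    show "bdd_above ((\<lambda>x. SUP h\<in>?D. norm (hessian V f x h)) ` V)"
      using B ne by (intro bdd_aboveI2[where M = B] cSUP_least) auto
  qed
  finally show ?thesis .
qed

lemma hessian_norm_nonneg: "bounded_hessian V f \<Longrightarrow> 0 \<le> hessian_norm V f"
  using hessian_le_hessian_norm[of f 0 0] norm_ge_zero order_trans
  by (metis V_intros(1) norm_zero zero_le_one)

lemma hessian_has_derivative:
  "gradient V f differentiable_on V \<Longrightarrow> x \<in> V \<Longrightarrow> (gradient V f has_derivative hessian V f x) (at x within V)"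
  unfolding hessian_def by (simp add: differentiable_on_def frechet_derivative_works[symmetric])

lemma gradient_along_segment:
  assumes f: "gradient V f differentiable_on V" and x: "x \<in> V" and h: "h \<in> V"
  shows "((\<lambda>t. gradient V f (x + t *\<^sub>R h)) has_vector_derivative hessian V f (x + t *\<^sub>R h) h) (at t within A)"
proof -
  have V: "x + t *\<^sub>R h \<in> V" for t using x h by simp
  have D: "(gradient V f has_derivative hessian V f (x + t *\<^sub>R h)) (at (x + t *\<^sub>R h) within V)"
    by (rule hessian_has_derivative[OF f V])
  have line: "((\<lambda>t. x + t *\<^sub>R h) has_derivative (\<lambda>t. t *\<^sub>R h)) (at t within A)"
    by (auto intro!: derivative_eq_intros)
  have "(\<lambda>t. x + t *\<^sub>R h) ` A \<subseteq> V" using V by auto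
  from has_derivative_in_compose[OF line has_derivative_subset[OF D this]]
  show ?thesis
    using linear_scale[OF has_derivative_linear[OF D]] by (simp add: has_vector_derivative_def)
qed

lemma gradient_lipschitz:
  assumes f: "gradient V f differentiable_on V" and b: "bounded_hessian V f"
  shows "(hessian_norm V f)-lipschitz_on V (gradient V f)"
proof (rule lipschitz_onI)
  fix x y assume x: "x \<in> V" and y: "y \<in> V"
  let ?h = "y - x"
  have h: "?h \<in> V" using x y by simp
  have "norm (gradient V f (x + 1 *\<^sub>R ?h) - gradient V f (x + 0 *\<^sub>R ?h)) \<le> hessian_norm V f * norm ?h * \<bar>1 - 0\<bar>"
  proof (rule increment_bound_within[where T = 1, OF gradient_along_segment[OF f x h]])
    fix t :: real
    let ?z = "x + t *\<^sub>R ?h"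
    have z: "?z \<in> V" using x h by simp
    have "hessian V f ?z ?h = norm ?h *\<^sub>R hessian V f ?z (sgn ?h)"
      using linear_scale[OF has_derivative_linear[OF hessian_has_derivative[OF f z]], of "norm ?h" "sgn ?h"]
      by (cases "?h = 0") (auto simp: sgn_div_norm)
    moreover have "norm (hessian V f ?z (sgn ?h)) \<le> hessian_norm V f"
    proof (rule hessian_le_hessian_norm[OF b z])
      show "sgn ?h \<in> V" using h by (simp add: sgn_div_norm)
      show "norm (sgn ?h) \<le> 1" by (simp add: norm_sgn)
    qed
    ultimately show "norm (hessian V f ?z ?h) \<le> hessian_norm V f * norm ?h"
      by (simp add: mult.commute[of "hessian_norm V f"] mult_left_mono)
  qed auto
  then show "dist (gradient V f x) (gradient V f y) \<le> hessian_norm V f * dist x y"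
    by (simp add: dist_norm norm_minus_commute)
qed (rule hessian_norm_nonneg[OF b])

lemma C2_on_gradient:
  assumes "C2_on V f" "x \<in> V"
  shows "gradient V f x \<in> V" "(f has_derivative (\<lambda>h. inner (gradient V f x) h)) (at x within V)"
  using has_gradient[of f x] assms by (auto simp: C2_on_def differentiable_on_def)

text \<open>
  The bound on the Hessian of \<open>H(x, \<cdot>)\<close> is integrated along the segment from \<open>p\<close> to \<open>p'\<close>. The
  gradient of \<open>H(x, \<cdot>)\<close> is the second component of the full gradient because \<open>p \<mapsto> (x, p)\<close> maps \<open>V\<close>
  into \<open>V \<times> V\<close>.
\<close>

lemma strong_monotonicity_in_p:
  assumes C2: "C2_on (V \<times> V) (\<lambda>(x, p). H x p)" and conv: "strongly_convex_in_p V H c"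
    and x: "x \<in> V" and p: "p \<in> V" "p' \<in> V"
  defines "gH \<equiv> gradient (V \<times> V) (\<lambda>(x, p). H x p)"
  shows "c * (norm (p' - p))\<^sup>2 \<le> inner (p' - p) (snd (gH (x, p')) - snd (gH (x, p)))"
proof -
  interpret VV: projected_subspace "V \<times> V" "\<lambda>z. (\<pi> (fst z), \<pi> (snd z))"
    by (rule projected_subspace_Times)
  have pair: "((\<lambda>p. (x, p)) has_derivative (\<lambda>h. (0, h))) (at p within V)" for p
    by (auto intro!: derivative_eq_intros)
  have sub: "(\<lambda>p. (x, p)) ` V \<subseteq> V \<times> V" using x by auto
  have grad: "gradient V (H x) p = snd (gH (x, p))" if p: "p \<in> V" for p
  proof (rule gradient_eqI[OF subspace_V p])
    have xp: "(x, p) \<in> V \<times> V" using x p by simp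
    show "snd (gH (x, p)) \<in> V"
      using VV.C2_on_gradient(1)[OF C2 xp] by (auto simp: gH_def mem_Times_iff)
    have "((\<lambda>(x, p). H x p) has_derivative (\<lambda>h. inner (gH (x, p)) h)) (at (x, p) within (\<lambda>p. (x, p)) ` V)"
      unfolding gH_def by (rule has_derivative_subset[OF VV.C2_on_gradient(2)[OF C2 xp] sub])
    from has_derivative_in_compose[OF pair this]
    show "(H x has_derivative (\<lambda>h. inner (snd (gH (x, p))) h)) (at p within V)"
      by (simp add: inner_prod_def)
  qed
  have diff: "gradient V (H x) differentiable_on V"
    unfolding differentiable_on_def
  proof
    fix p assume p: "p \<in> V"
    have "(gH has_derivative hessian (V \<times> V) (\<lambda>(x, p). H x p) (x, p)) (at (x, p) within V \<times> V)"
      unfolding gH_def by (rule VV.hessian_has_derivative) (use C2 x p in \<open>auto simp: C2_on_def\<close>)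
    from has_derivative_in_compose[OF pair has_derivative_subset[OF this sub]]
    have "(\<lambda>p. gH (x, p)) differentiable (at p within V)"
      by (auto simp: differentiable_def)
    then have "(\<lambda>p. snd (gH (x, p))) differentiable (at p within V)"
      using bounded_linear.has_derivative[OF bounded_linear_snd] by (fastforce simp: differentiable_def)
    then show "gradient V (H x) differentiable (at p within V)"
      by (rule differentiable_transform_within[OF _ zero_less_one p]) (simp add: grad)
  qed
  let ?h = "p' - p"
  have h: "?h \<in> V" using p by simp
  define f where "f t = inner ?h (gradient V (H x) (p + t *\<^sub>R ?h)) - c * (norm ?h)\<^sup>2 * t" for t
  define f' where "f' t = inner ?h (hessian V (H x) (p + t *\<^sub>R ?h) ?h) - c * (norm ?h)\<^sup>2" for t
  have "f 0 \<le> f 1"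
  proof (rule nondecreasing_on_interval[where f = f and f' = f'])
    fix t :: real
    have "((\<lambda>t. inner ?h (gradient V (H x) (p + t *\<^sub>R ?h))) has_vector_derivative
        inner ?h (hessian V (H x) (p + t *\<^sub>R ?h) ?h)) (at t within {0..1})"
      by (rule bounded_linear.has_vector_derivative[OF bounded_linear_inner_right gradient_along_segment[OF diff p(1) h]])
    then have "((\<lambda>t. inner ?h (gradient V (H x) (p + t *\<^sub>R ?h))) has_real_derivative
        inner ?h (hessian V (H x) (p + t *\<^sub>R ?h) ?h)) (at t within {0..1})"
      by (simp add: has_real_derivative_iff_has_vector_derivative)
    then show "(f has_real_derivative f' t) (at t within {0..1})"
      unfolding f_def f'_def by (auto intro!: derivative_eq_intros)
    have "c * inner ?h ?h \<le> inner (hessian V (H x) (p + t *\<^sub>R ?h) ?h) ?h"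
      using conv x p h unfolding strongly_convex_in_p_def by (meson V_intros)
    then show "0 \<le> f' t"
      by (simp add: f'_def inner_commute dot_square_norm)
  qed simp
  then show ?thesis
    using grad p by (simp add: f_def inner_diff_right)
qed

end

section \<open>The flow of characteristics\<close>

text \<open>
  The hypotheses behind well-posedness on \<open>[0, T]\<close>: Lipschitz gradients \<open>gH = (H\<^sub>x, H\<^sub>p)\<close> and
  \<open>gG\<close>, and two monotonicity conditions with a common weight \<open>m\<close>. \<open>H_mono\<close> says that
  \<open>\<delta>X \<bullet> \<delta>P + m |\<delta>X|\<^sup>2\<close> does not decrease along two characteristics, \<open>G_mono\<close> that it starts above
  \<open>|\<delta>y|\<^sup>2\<close>.
\<close>

locale hamilton_jacobi = projected_subspace V \<pi>
  for V :: "'a::{real_inner, banach} set" and \<pi> :: "'a \<Rightarrow> 'a" +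
  fixes H :: "'a \<Rightarrow> 'a \<Rightarrow> real" and gH :: "'a \<times> 'a \<Rightarrow> 'a \<times> 'a"
    and G :: "'a \<Rightarrow> real" and gG :: "'a \<Rightarrow> 'a" and L K m T :: real
  assumes H_deriv: "\<And>z. z \<in> V \<times> V \<Longrightarrow> ((\<lambda>(x, p). H x p) has_derivative (\<lambda>h. inner (gH z) h)) (at z within V \<times> V)"
    and gH_in: "\<And>z. z \<in> V \<times> V \<Longrightarrow> gH z \<in> V \<times> V"
    and gH_lip: "L-lipschitz_on (V \<times> V) gH"
    and G_deriv: "\<And>x. x \<in> V \<Longrightarrow> (G has_derivative (\<lambda>h. inner (gG x) h)) (at x within V)"
    and gG_in: "\<And>x. x \<in> V \<Longrightarrow> gG x \<in> V"
    and gG_lip: "K-lipschitz_on V gG"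
    and H_mono: "\<And>z z'. z \<in> V \<times> V \<Longrightarrow> z' \<in> V \<times> V \<Longrightarrow>
       0 \<le> inner (snd z' - snd z) (snd (gH z') - snd (gH z)) - inner (fst z' - fst z) (fst (gH z') - fst (gH z))
         + 2 * m * inner (fst z' - fst z) (snd (gH z') - snd (gH z))"
    and G_mono: "\<And>x x'. x \<in> V \<Longrightarrow> x' \<in> V \<Longrightarrow> (norm (x' - x))\<^sup>2 \<le> inner (x' - x) (gG x' - gG x) + m * (norm (x' - x))\<^sup>2"
    and m_nonneg: "0 \<le> m" and T_pos: "0 < T"
begin

lemma L_nonneg: "0 \<le> L" and K_nonneg: "0 \<le> K"
  using gH_lip gG_lip by (auto dest: lipschitz_on_nonneg)

definition hamilton_field :: "'a \<times> 'a \<Rightarrow> 'a \<times> 'a" where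
  "hamilton_field z = (snd (gH z), - fst (gH z))"

lemma hamilton_field_in: "z \<in> V \<times> V \<Longrightarrow> hamilton_field z \<in> V \<times> V"
  using gH_in[of z] by (auto simp: hamilton_field_def mem_Times_iff)

lemma hamilton_field_lip: "L-lipschitz_on (V \<times> V) hamilton_field"
proof (rule lipschitz_onI)
  fix z z' assume "z \<in> V \<times> V" "z' \<in> V \<times> V"
  then have "norm (gH z - gH z') \<le> L * norm (z - z')"
    by (rule lipschitz_on_normD[OF gH_lip])
  moreover have "norm (hamilton_field z - hamilton_field z') = norm (gH z - gH z')"
    by (simp add: hamilton_field_def norm_prod_def add.commute norm_minus_commute)
  ultimately show "dist (hamilton_field z) (hamilton_field z') \<le> L * dist z z'"
    by (simp add: dist_norm)
qed (rule L_nonneg)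

text \<open>
  The vector field is known on \<open>V \<times> V\<close> only, so the equation is solved in the ambient space for
  its composition with the projection. The component of the solution outside \<open>V \<times> V\<close> has derivative
  zero and starts at zero.
\<close>

lemma characteristic_exists:
  assumes y: "y \<in> V"
  shows "\<exists>z. z 0 = (y, gG y) \<and> (\<forall>s\<in>{0..T}. z s \<in> V \<times> V \<and> (z has_vector_derivative hamilton_field (z s)) (at s within {0..T}))"
proof -
  interpret VV: projected_subspace "V \<times> V" "\<lambda>z. (\<pi> (fst z), \<pi> (snd z))"
    by (rule projected_subspace_Times)
  let ?\<Pi> = "\<lambda>z. (\<pi> (fst z), \<pi> (snd z))"
  obtain B where B: "B \<ge> 0" "\<And>z. norm (?\<Pi> z) \<le> norm z * B"
    using bounded_linear.nonneg_bounded[OF VV.bounded_linear_\<pi>] by blast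
  have "B-lipschitz_on UNIV ?\<Pi>"
  proof (rule lipschitz_onI)
    fix z z'
    show "dist (?\<Pi> z) (?\<Pi> z') \<le> B * dist z z'"
      using B(2)[of "z - z'"] linear_diff[OF bounded_linear.linear[OF VV.bounded_linear_\<pi>], of z z']
      by (simp add: dist_norm mult.commute)
  qed (rule B)
  moreover have "L-lipschitz_on (range ?\<Pi>) hamilton_field"
    by (rule lipschitz_on_subset[OF hamilton_field_lip]) (use VV.\<pi>_in in blast)
  ultimately have "(L * B)-lipschitz_on UNIV (\<lambda>z. hamilton_field (?\<Pi> z))"
    using lipschitz_on_compose2 by blast
  from lipschitz_ode_exists[OF this less_imp_le[OF T_pos], of "(y, gG y)"] obtain z
    where z0: "z 0 = (y, gG y)"
      and z: "\<And>s. s \<in> {0..T} \<Longrightarrow> (z has_vector_derivative hamilton_field (?\<Pi> (z s))) (at s within {0..T})"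
    by blast
  have fV: "hamilton_field (?\<Pi> w) \<in> V \<times> V" for w
    by (rule hamilton_field_in) (rule VV.\<pi>_in)
  have "((\<lambda>s. z s - ?\<Pi> (z s)) has_vector_derivative 0) (at s within {0..T})" if "s \<in> {0..T}" for s
  proof -
    have "((\<lambda>s. z s - ?\<Pi> (z s)) has_vector_derivative (hamilton_field (?\<Pi> (z s)) - ?\<Pi> (hamilton_field (?\<Pi> (z s))))) (at s within {0..T})"
      by (intro has_vector_derivative_diff z that
          bounded_linear.has_vector_derivative[OF VV.bounded_linear_\<pi>])
    then show ?thesis
      using VV.\<pi>_id[OF fV] by simp
  qed
  then have "norm ((z s - ?\<Pi> (z s)) - (z 0 - ?\<Pi> (z 0))) \<le> 0 * \<bar>s - 0\<bar>" if "s \<in> {0..T}" for s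
    by (rule increment_bound_within[where f' = "\<lambda>_. 0"]) (use that T_pos in auto)
  moreover have "z 0 - ?\<Pi> (z 0) = 0"
    using y gG_in[OF y] by (simp add: z0 \<pi>_id zero_prod_def)
  ultimately have stay: "?\<Pi> (z s) = z s" if "s \<in> {0..T}" for s
    using that by simp
  then have "z s \<in> V \<times> V" if "s \<in> {0..T}" for s
    using VV.\<pi>_in that by metis
  then show ?thesis
    using z0 z stay by (intro exI[of _ z]) auto
qed

definition traj :: "'a \<Rightarrow> real \<Rightarrow> 'a \<times> 'a" where
  "traj y = (SOME z. z 0 = (y, gG y) \<and>
     (\<forall>s\<in>{0..T}. z s \<in> V \<times> V \<and> (z has_vector_derivative hamilton_field (z s)) (at s within {0..T})))"

definition X :: "real \<Rightarrow> 'a \<Rightarrow> 'a" where "X s y = fst (traj y s)"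
definition P :: "real \<Rightarrow> 'a \<Rightarrow> 'a" where "P s y = snd (traj y s)"

lemma traj:
  assumes "y \<in> V"
  shows "traj y 0 = (y, gG y)"
    and "s \<in> {0..T} \<Longrightarrow> traj y s \<in> V \<times> V"
    and "s \<in> {0..T} \<Longrightarrow> (traj y has_vector_derivative hamilton_field (traj y s)) (at s within {0..T})"
proof -
  have *: "traj y 0 = (y, gG y) \<and> (\<forall>s\<in>{0..T}. traj y s \<in> V \<times> V \<and>
      (traj y has_vector_derivative hamilton_field (traj y s)) (at s within {0..T}))"
    unfolding traj_def by (rule someI_ex[OF characteristic_exists[OF assms]])
  show "traj y 0 = (y, gG y)" using * by simp
  show "s \<in> {0..T} \<Longrightarrow> traj y s \<in> V \<times> V" using * by blast
  show "s \<in> {0..T} \<Longrightarrow> (traj y has_vector_derivative hamilton_field (traj y s)) (at s within {0..T})"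
    using * by blast
qed

lemma traj_eq: "traj y s = (X s y, P s y)"
  by (simp add: X_def P_def)

lemma X_0: "y \<in> V \<Longrightarrow> X 0 y = y" and P_0: "y \<in> V \<Longrightarrow> P 0 y = gG y"
  by (simp_all add: X_def P_def traj)

lemma X_in: "y \<in> V \<Longrightarrow> s \<in> {0..T} \<Longrightarrow> X s y \<in> V" and P_in: "y \<in> V \<Longrightarrow> s \<in> {0..T} \<Longrightarrow> P s y \<in> V"
  using traj(2)[of y s] by (auto simp: traj_eq)

lemma X_deriv: "y \<in> V \<Longrightarrow> s \<in> {0..T} \<Longrightarrow>
    ((\<lambda>s. X s y) has_vector_derivative snd (gH (traj y s))) (at s within {0..T})"
  and P_deriv: "y \<in> V \<Longrightarrow> s \<in> {0..T} \<Longrightarrow>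
    ((\<lambda>s. P s y) has_vector_derivative - fst (gH (traj y s))) (at s within {0..T})"
  unfolding X_def P_def
  using bounded_linear.has_vector_derivative[OF bounded_linear_fst traj(3)]
    bounded_linear.has_vector_derivative[OF bounded_linear_snd traj(3)]
  by (auto simp: hamilton_field_def)

lemma traj_continuous: "y \<in> V \<Longrightarrow> continuous_on {0..T} (traj y)"
  by (rule continuous_on_vector_derivative[of _ _ "\<lambda>s. hamilton_field (traj y s)"]) (rule traj(3))

text \<open>
  The Lipschitz constant of the flow in the starting point: Gronwall's factor over \<open>[0, T]\<close> times
  the Lipschitz constant of \<open>y \<mapsto> (y, DG(y))\<close>.
\<close>

definition E :: real where "E = exp (L * T) * (1 + K)"

lemma E_pos: "0 < E"
  using K_nonneg by (simp add: E_def add_pos_nonneg)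

lemma traj_lipschitz:
  assumes y: "y \<in> V" "y' \<in> V" and s: "s \<in> {0..T}"
  shows "norm (traj y' s - traj y s) \<le> E * norm (y' - y)"
proof -
  have "norm (traj y' s - traj y s) \<le> exp (L * s) * norm (traj y' 0 - traj y 0)"
    by (rule norm_exp_growth[where z' = "\<lambda>s. hamilton_field (traj y' s) - hamilton_field (traj y s)", OF _ _ s])
      (intro has_vector_derivative_diff traj lipschitz_on_normD[OF hamilton_field_lip] y; assumption)+
  also have "norm (traj y' 0 - traj y 0) \<le> (1 + K) * norm (y' - y)"
  proof -
    have "norm (y' - y, gG y' - gG y) \<le> norm (y' - y) + norm (gG y' - gG y)"
      by (rule norm_Pair_le)
    also have "norm (gG y' - gG y) \<le> K * norm (y' - y)"
      by (rule lipschitz_on_normD[OF gG_lip]) (use y in auto)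
    finally show ?thesis using y by (simp add: traj algebra_simps)
  qed
  also have "exp (L * s) \<le> exp (L * T)"
    using s L_nonneg by (auto intro: mult_left_mono)
  finally show ?thesis
    using K_nonneg by (simp add: E_def mult.assoc mult_left_mono mult_right_mono)
qed

lemma X_lipschitz: "y \<in> V \<Longrightarrow> y' \<in> V \<Longrightarrow> s \<in> {0..T} \<Longrightarrow> norm (X s y' - X s y) \<le> E * norm (y' - y)"
  and P_lipschitz: "y \<in> V \<Longrightarrow> y' \<in> V \<Longrightarrow> s \<in> {0..T} \<Longrightarrow> norm (P s y' - P s y) \<le> E * norm (y' - y)"
  using traj_lipschitz[of y y' s] norm_fst_le[of "X s y' - X s y" "P s y' - P s y"]
    norm_snd_le[of "P s y' - P s y" "X s y' - X s y"]
  by (auto simp: traj_eq)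

text \<open>
  The estimate that keeps characteristics apart; the derivative of the right-hand side is the
  expression in \<open>H_mono\<close>.
\<close>

lemma displacement_monotone:
  assumes y: "y \<in> V" "y' \<in> V" and s: "s \<in> {0..T}"
  shows "(norm (y' - y))\<^sup>2 \<le> inner (X s y' - X s y) (P s y' - P s y) + m * (norm (X s y' - X s y))\<^sup>2"
proof -
  define f where "f s = inner (X s y' - X s y) (P s y' - P s y) + m * inner (X s y' - X s y) (X s y' - X s y)" for s
  define f' where "f' s =
     inner (P s y' - P s y) (snd (gH (traj y' s)) - snd (gH (traj y s)))
     - inner (X s y' - X s y) (fst (gH (traj y' s)) - fst (gH (traj y s)))
     + 2 * m * inner (X s y' - X s y) (snd (gH (traj y' s)) - snd (gH (traj y s)))" for s
  have "f 0 \<le> f s"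
  proof (rule nondecreasing_on_interval[where f = f and f' = f'])
    fix r assume r: "r \<in> {0..s}"
    then have r': "r \<in> {0..T}" using s by auto
    have sub: "{0..s} \<subseteq> {0..T}" using s by auto
    note X' = has_vector_derivative_within_subset[OF X_deriv[OF _ r'] sub, unfolded has_vector_derivative_def]
    note P' = has_vector_derivative_within_subset[OF P_deriv[OF _ r'] sub, unfolded has_vector_derivative_def]
    show "(f has_real_derivative f' r) (at r within {0..s})"
      unfolding f_def f'_def has_field_derivative_def
      by (rule derivative_eq_intros X'[OF y(1)] X'[OF y(2)] P'[OF y(1)] P'[OF y(2)] refl)+
        (auto simp: inner_commute algebra_simps inner_diff_left inner_diff_right)
    show "f' r \<ge> 0"
      using H_mono[OF traj(2)[OF y(1) r'] traj(2)[OF y(2) r']] by (simp add: f'_def X_def P_def)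
  qed (use s in auto)
  moreover have "(norm (y' - y))\<^sup>2 \<le> f 0"
    using G_mono[OF y] by (simp add: f_def X_0 P_0 y dot_square_norm)
  ultimately show ?thesis
    by (simp add: f_def dot_square_norm)
qed

definition \<kappa> :: real where "\<kappa> = (1 + m) * E"

lemma \<kappa>_pos: "0 < \<kappa>"
  using m_nonneg E_pos by (simp add: \<kappa>_def)

text \<open>
  In \<open>displacement_monotone\<close> one factor \<open>|\<delta>X|\<close> is kept and the other factor, \<open>|\<delta>P|\<close> or \<open>|\<delta>X|\<close>, is
  at most \<open>E |\<delta>y|\<close>; dividing by \<open>|\<delta>y|\<close> leaves the claim.
\<close>

lemma X_lower_bound:
  assumes y: "y \<in> V" "y' \<in> V" and s: "s \<in> {0..T}"
  shows "norm (y' - y) \<le> \<kappa> * norm (X s y' - X s y)"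
proof (cases "y' = y")
  case False
  let ?n = "norm (y' - y)" and ?a = "norm (X s y' - X s y)"
  have "?n\<^sup>2 \<le> inner (X s y' - X s y) (P s y' - P s y) + m * ?a\<^sup>2"
    by (rule displacement_monotone[OF assms])
  also have "inner (X s y' - X s y) (P s y' - P s y) \<le> ?a * norm (P s y' - P s y)"
    by (rule norm_cauchy_schwarz)
  also have "\<dots> \<le> ?a * (E * ?n)"
    by (intro mult_left_mono P_lipschitz assms) auto
  also have "m * ?a\<^sup>2 \<le> m * (?a * (E * ?n))"
    unfolding power2_eq_square by (intro mult_left_mono X_lipschitz assms m_nonneg) auto
  finally have "?n * ?n \<le> (\<kappa> * ?a) * ?n"
    by (simp add: \<kappa>_def power2_eq_square algebra_simps)
  then show ?thesis
    using False by simp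
qed (use \<kappa>_pos in simp)

lemma X_onto:
  assumes s: "s \<in> {0..T}"
  shows "X s ` V = V"
proof (rule surjective_by_continuation[where X = X, OF closed_V subspace_V _ _ _ _ _ _ s])
  show "X 0 ` V = V" by (auto simp: X_0 image_iff)
  show "X s ` V \<subseteq> V" if "s \<in> {0..T}" for s using X_in that by auto
  show "norm (x - y) \<le> \<kappa> * norm (X s x - X s y)" if "s \<in> {0..T}" "x \<in> V" "y \<in> V" for s x y
    using X_lower_bound[of y x s] that by simp
  show "norm ((X t x - X s x) - (X t y - X s y)) \<le> L * E * \<bar>t - s\<bar> * norm (x - y)"
    if st: "s \<in> {0..T}" "t \<in> {0..T}" and xy: "x \<in> V" "y \<in> V" for s t x y
  proof -
    have "norm ((X t x - X t y) - (X s x - X s y)) \<le> (L * (E * norm (x - y))) * \<bar>t - s\<bar>"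
    proof (rule increment_bound_within[OF _ _ st])
      fix r assume r: "r \<in> {0..T}"
      show "((\<lambda>r. X r x - X r y) has_vector_derivative snd (gH (traj x r)) - snd (gH (traj y r))) (at r within {0..T})"
        by (intro derivative_intros X_deriv xy r)
      have "norm (snd (gH (traj x r)) - snd (gH (traj y r))) \<le> norm (gH (traj x r) - gH (traj y r))"
        by (metis norm_snd_le prod.collapse snd_diff)
      also have "\<dots> \<le> L * norm (traj x r - traj y r)"
        by (intro lipschitz_on_normD[OF gH_lip] traj xy r)
      also have "\<dots> \<le> L * (E * norm (x - y))"
        by (intro mult_left_mono traj_lipschitz xy r L_nonneg)
      finally show "norm (snd (gH (traj x r)) - snd (gH (traj y r))) \<le> L * (E * norm (x - y))" .
    qed
    then show ?thesis
      by (simp add: algebra_simps)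
  qed
qed (use \<kappa>_pos E_pos L_nonneg in auto)

end

section \<open>The value transported along characteristics\<close>

context hamilton_jacobi
begin

text \<open>
  The starting point of the characteristic that is at \<open>x\<close> at time \<open>s\<close>.
\<close>

definition S :: "real \<Rightarrow> 'a \<Rightarrow> 'a" where "S s = inv_into V (X s)"

lemma S_in: "s \<in> {0..T} \<Longrightarrow> x \<in> V \<Longrightarrow> S s x \<in> V"
  and X_S: "s \<in> {0..T} \<Longrightarrow> x \<in> V \<Longrightarrow> X s (S s x) = x"
  using X_onto[of s] by (auto simp: S_def inv_into_into f_inv_into_f)

lemma S_X: "s \<in> {0..T} \<Longrightarrow> y \<in> V \<Longrightarrow> S s (X s y) = y"
  using X_lower_bound[of "S s (X s y)" y s] by (simp add: S_in X_in X_S)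

text \<open>
  The candidate for the gradient.
\<close>

definition q :: "real \<Rightarrow> 'a \<Rightarrow> 'a" where "q s x = P s (S s x)"

lemma q_in: "s \<in> {0..T} \<Longrightarrow> x \<in> V \<Longrightarrow> q s x \<in> V"
  by (simp add: q_def P_in S_in)

text \<open>
  The rate at which the value changes along a characteristic, the Legendre transform
  \<open>P \<bullet> H\<^sub>p - H\<close>.
\<close>

definition action_density :: "'a \<Rightarrow> real \<Rightarrow> real" where
  "action_density y r = inner (P r y) (snd (gH (traj y r))) - H (X r y) (P r y)"

definition U :: "real \<Rightarrow> 'a \<Rightarrow> real" where
  "U s y = G y + integral {0..s} (action_density y)"

lemma H_continuous: "continuous_on (V \<times> V) (\<lambda>(x, p). H x p)"
  by (rule has_derivative_continuous_on) (rule H_deriv)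

lemma gH_continuous: "continuous_on (V \<times> V) gH"
  by (rule lipschitz_on_continuous_on[OF gH_lip])

lemma U_deriv:
  assumes y: "y \<in> V" and s: "s \<in> {0..T}"
  shows "((\<lambda>s. U s y) has_vector_derivative action_density y s) (at s within {0..T})"
proof -
  have tr: "traj y ` {0..T} \<subseteq> V \<times> V" by (rule image_subsetI) (rule traj(2)[OF y])
  have "continuous_on {0..T} (\<lambda>r. (\<lambda>(x, p). H x p) (traj y r))"
    by (rule continuous_on_compose2[OF H_continuous traj_continuous[OF y] tr])
  moreover have "continuous_on {0..T} (\<lambda>r. gH (traj y r))"
    by (rule continuous_on_compose2[OF gH_continuous traj_continuous[OF y] tr])
  moreover have "continuous_on {0..T} (\<lambda>r. snd (traj y r))"
    by (intro continuous_intros traj_continuous y)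
  ultimately have "continuous_on {0..T} (action_density y)"
    unfolding action_density_def by (auto simp: X_def P_def case_prod_beta intro!: continuous_intros)
  then have "((\<lambda>s. integral {0..s} (action_density y)) has_vector_derivative action_density y s) (at s within {0..T})"
    using s by (rule integral_has_vector_derivative)
  then show ?thesis
    unfolding U_def using has_vector_derivative_add[OF has_vector_derivative_const] by force
qed

definition M :: real where "M = (K + 2 * L * E\<^sup>2 * T) * \<kappa>\<^sup>2"

text \<open>
  The derivative in \<open>s\<close> of the left-hand expression contains no first order terms in \<open>\<delta>X\<close> and
  \<open>\<delta>P\<close>: by the Hamiltonian system it is a Taylor remainder of \<open>H\<close> plus \<open>\<delta>P \<bullet> \<delta>H\<^sub>p\<close>. Hence it is
  of order \<open>|\<delta>y|\<^sup>2\<close>, like its initial value, a Taylor remainder of \<open>G\<close>; and \<open>|\<delta>y| \<le> \<kappa> |\<delta>X|\<close>.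
\<close>

lemma U_expansion:
  assumes y: "y \<in> V" "y' \<in> V" and s: "s \<in> {0..T}"
  shows "\<bar>U s y' - U s y - inner (P s y) (X s y' - X s y)\<bar> \<le> M * (norm (X s y' - X s y))\<^sup>2"
proof -
  define R where "R s = U s y' - U s y - inner (P s y) (X s y' - X s y)" for s
  define R' where "R' s = action_density y' s - action_density y s
     - (inner (P s y) (snd (gH (traj y' s)) - snd (gH (traj y s))) + inner (- fst (gH (traj y s))) (X s y' - X s y))" for s
  let ?n = "norm (y' - y)"
  have "norm (R s - R 0) \<le> (2 * L * E\<^sup>2 * ?n\<^sup>2) * \<bar>s - 0\<bar>"
  proof (rule increment_bound_within[where f' = R'])
    fix r assume r: "r \<in> {0..T}"
    show "(R has_vector_derivative R' r) (at r within {0..T})"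
      unfolding R_def R'_def
      by (intro has_vector_derivative_diff U_deriv y r
          bounded_bilinear.has_vector_derivative[OF bounded_bilinear_inner] X_deriv P_deriv)
    let ?z = "traj y r" and ?z' = "traj y' r"
    have z: "?z \<in> V \<times> V" "?z' \<in> V \<times> V" by (intro traj y r)+
    have "R' r = - (H (X r y') (P r y') - H (X r y) (P r y) - inner (gH ?z) (?z' - ?z))
        + inner (P r y' - P r y) (snd (gH ?z') - snd (gH ?z))"
      by (simp add: R'_def action_density_def inner_prod_def X_def[symmetric] P_def[symmetric]
          inner_diff_left inner_diff_right inner_commute)
    moreover have "\<bar>H (X r y') (P r y') - H (X r y) (P r y) - inner (gH ?z) (?z' - ?z)\<bar> \<le> L * (norm (?z' - ?z))\<^sup>2"
      using taylor_lipschitz_gradient[OF subspace_imp_convex[OF subspace_VV] H_deriv gH_lip z]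
      by (simp add: case_prod_beta X_def P_def)
    moreover have "\<bar>inner (P r y' - P r y) (snd (gH ?z') - snd (gH ?z))\<bar> \<le> L * (norm (?z' - ?z))\<^sup>2"
    proof -
      have "\<bar>inner (P r y' - P r y) (snd (gH ?z') - snd (gH ?z))\<bar> \<le> norm (P r y' - P r y) * norm (snd (gH ?z') - snd (gH ?z))"
        by (rule Cauchy_Schwarz_ineq2)
      also have "\<dots> \<le> norm (?z' - ?z) * norm (gH ?z' - gH ?z)"
        by (intro mult_mono) (metis norm_snd_le prod.collapse snd_diff P_def, metis norm_snd_le prod.collapse snd_diff, auto)
      also have "\<dots> \<le> norm (?z' - ?z) * (L * norm (?z' - ?z))"
        by (intro mult_left_mono lipschitz_on_normD[OF gH_lip] z) auto
      finally show ?thesis by (simp add: power2_eq_square mult_ac)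
    qed
    ultimately have "norm (R' r) \<le> 2 * L * (norm (?z' - ?z))\<^sup>2"
      by simp
    also have "\<dots> \<le> 2 * L * (E * ?n)\<^sup>2"
      using L_nonneg by (intro mult_left_mono power_mono traj_lipschitz y r) auto
    finally show "norm (R' r) \<le> 2 * L * E\<^sup>2 * ?n\<^sup>2"
      by (simp add: power_mult_distrib)
  qed (use s T_pos in auto)
  also have "\<dots> \<le> (2 * L * E\<^sup>2 * ?n\<^sup>2) * T"
    using s L_nonneg by (intro mult_left_mono) auto
  finally have "\<bar>R s - R 0\<bar> \<le> 2 * L * E\<^sup>2 * ?n\<^sup>2 * T" by simp
  moreover have "\<bar>R 0\<bar> \<le> K * ?n\<^sup>2"
    using taylor_lipschitz_gradient[OF convex_V G_deriv gG_lip y] by (simp add: R_def U_def X_0 P_0 y)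
  ultimately have "\<bar>R s\<bar> \<le> (K + 2 * L * E\<^sup>2 * T) * ?n\<^sup>2"
    by (simp add: algebra_simps)
  also have "\<dots> \<le> (K + 2 * L * E\<^sup>2 * T) * (\<kappa> * norm (X s y' - X s y))\<^sup>2"
    using K_nonneg L_nonneg T_pos
    by (intro mult_left_mono power_mono X_lower_bound assms) auto
  finally show ?thesis
    by (simp add: R_def M_def power_mult_distrib)
qed

definition w :: "real \<Rightarrow> 'a \<Rightarrow> real" where "w s x = U s (S s x)"

text \<open>
  The base point \<open>X s y\<close> and the point of evaluation \<open>x\<close> are independent of each other. With
  \<open>s\<close> and \<open>y\<close> fixed, varying \<open>x\<close> gives the space derivative; with \<open>x\<close> and \<open>y\<close> fixed, varying \<open>s\<close>
  gives the time derivative.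
\<close>

lemma w_expansion:
  assumes "s \<in> {0..T}" "y \<in> V" "x \<in> V"
  shows "\<bar>w s x - U s y - inner (P s y) (x - X s y)\<bar> \<le> M * (norm (x - X s y))\<^sup>2"
  using U_expansion[of y "S s x" s] assms by (simp add: w_def S_in X_S)

lemma w_space_deriv:
  assumes s: "s \<in> {0..T}" and x: "x \<in> V"
  shows "(w s has_derivative (\<lambda>h. inner (q s x) h)) (at x within V)"
proof (rule has_derivative_quadratic_perturbation[OF _ x])
  show "((\<lambda>x'. w s x + inner (q s x) (x' - x)) has_derivative (\<lambda>h. inner (q s x) h)) (at x within V)"
    by (auto intro!: derivative_eq_intros)
  fix x' assume "x' \<in> V"
  then show "norm (w s x' - (w s x + inner (q s x) (x' - x))) \<le> M * (norm (x' - x))\<^sup>2"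
    using w_expansion[of s "S s x" x'] s x by (simp add: S_in X_S w_def q_def algebra_simps)
qed

lemma hamilton_field_bound: "\<exists>B\<ge>0. \<forall>y\<in>V. \<forall>r\<in>{0..T}. norm (hamilton_field (traj y r)) \<le> B + L * E * norm y"
proof -
  have "continuous_on {0..T} (\<lambda>r. hamilton_field (traj 0 r))"
    by (rule continuous_on_compose2[OF lipschitz_on_continuous_on[OF hamilton_field_lip] traj_continuous])
      (auto intro!: image_subsetI traj(2) simp del: mem_Sigma_iff)
  then have "bounded ((\<lambda>r. hamilton_field (traj 0 r)) ` {0..T})"
    by (intro compact_imp_bounded compact_continuous_image) auto
  then obtain B where B: "B > 0" "\<And>r. r \<in> {0..T} \<Longrightarrow> norm (hamilton_field (traj 0 r)) \<le> B"
    unfolding bounded_pos by auto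
  have "norm (hamilton_field (traj y r)) \<le> B + L * E * norm y" if y: "y \<in> V" and r: "r \<in> {0..T}" for y r
  proof -
    have "norm (hamilton_field (traj y r)) \<le> norm (hamilton_field (traj 0 r)) + norm (hamilton_field (traj y r) - hamilton_field (traj 0 r))"
      by (metis add.commute diff_add_cancel norm_triangle_ineq)
    also have "norm (hamilton_field (traj y r) - hamilton_field (traj 0 r)) \<le> L * norm (traj y r - traj 0 r)"
      by (intro lipschitz_on_normD[OF hamilton_field_lip] traj y r V_intros)
    also have "\<dots> \<le> L * (E * norm (y - 0))"
      by (intro mult_left_mono traj_lipschitz y r L_nonneg V_intros)
    finally show ?thesis using B(2)[OF r] by simp
  qed
  then show ?thesis using B(1) by (intro exI[of _ B]) auto
qed

lemma traj_time_lipschitz: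
  "\<exists>B\<ge>0. \<forall>y\<in>V. \<forall>s\<in>{0..T}. \<forall>t\<in>{0..T}. norm (traj y t - traj y s) \<le> (B + L * E * norm y) * \<bar>t - s\<bar>"
proof -
  obtain B where B: "B \<ge> 0" "\<And>y r. y \<in> V \<Longrightarrow> r \<in> {0..T} \<Longrightarrow> norm (hamilton_field (traj y r)) \<le> B + L * E * norm y"
    using hamilton_field_bound by blast
  then have "norm (traj y t - traj y s) \<le> (B + L * E * norm y) * \<bar>t - s\<bar>"
    if "y \<in> V" "s \<in> {0..T}" "t \<in> {0..T}" for y s t
    using traj(3) that by (intro increment_bound_within[where f' = "\<lambda>r. hamilton_field (traj y r)"]) auto
  then show ?thesis using B(1) by blast
qed

text \<open>
  Expand \<open>w t x\<close> around the position at time \<open>t\<close> of the characteristic that passes \<open>x\<close> at time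
  \<open>s\<close>. That position differs from \<open>x\<close> by \<open>O(|t - s|)\<close>, so the error is quadratic in time, and the
  model has derivative \<open>(P \<bullet> H\<^sub>p - H) - P \<bullet> H\<^sub>p = - H\<close>.
\<close>

lemma w_time_deriv:
  assumes s: "s \<in> {0..T}" and x: "x \<in> V"
  shows "((\<lambda>s. w s x) has_vector_derivative - H x (q s x)) (at s within {0..T})"
proof -
  define y where "y = S s x"
  have y: "y \<in> V" "X s y = x" "P s y = q s x" using s x by (auto simp: y_def S_in X_S q_def)
  obtain B where B: "B \<ge> 0" "\<And>t. t \<in> {0..T} \<Longrightarrow> norm (traj y t - traj y s) \<le> (B + L * E * norm y) * \<bar>t - s\<bar>"
    using traj_time_lipschitz y(1) s by blast
  define a where "a t = U t y + inner (P t y) (x - X t y)" for t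
  have "(a has_vector_derivative
      action_density y s + (inner (P s y) (0 - snd (gH (traj y s))) + inner (- fst (gH (traj y s))) (x - X s y)))
      (at s within {0..T})"
    unfolding a_def
    by (intro has_vector_derivative_add has_vector_derivative_diff has_vector_derivative_const U_deriv y s
        bounded_bilinear.has_vector_derivative[OF bounded_bilinear_inner] X_deriv P_deriv)
  then have a: "(a has_vector_derivative - H x (q s x)) (at s within {0..T})"
    by (simp add: y action_density_def)
  show ?thesis
    unfolding has_vector_derivative_def
  proof (rule has_derivative_quadratic_perturbation[OF a[unfolded has_vector_derivative_def] s])
    fix t assume t: "t \<in> {0..T}"
    have "norm (x - X t y) = norm (X t y - X s y)" by (simp add: y norm_minus_commute)
    also have "\<dots> \<le> norm (traj y t - traj y s)"
      by (simp add: traj_eq norm_fst_le)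
    also have "\<dots> \<le> (B + L * E * norm y) * \<bar>t - s\<bar>" by (rule B(2)[OF t])
    finally have "(norm (x - X t y))\<^sup>2 \<le> ((B + L * E * norm y) * \<bar>t - s\<bar>)\<^sup>2"
      by (intro power_mono) auto
    moreover have "M \<ge> 0" using K_nonneg L_nonneg T_pos by (simp add: M_def)
    ultimately have "M * (norm (x - X t y))\<^sup>2 \<le> M * ((B + L * E * norm y) * \<bar>t - s\<bar>)\<^sup>2"
      by (rule mult_left_mono)
    moreover have "M * ((B + L * E * norm y) * \<bar>t - s\<bar>)\<^sup>2 = M * (B + L * E * norm y)\<^sup>2 * (norm (t - s))\<^sup>2"
      unfolding power_mult_distrib by simp
    moreover have "norm (w t x - a t) \<le> M * (norm (x - X t y))\<^sup>2"
      using w_expansion[OF t y(1) x] by (simp add: a_def diff_diff_add)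
    ultimately show "norm (w t x - a t) \<le> M * (B + L * E * norm y)\<^sup>2 * (norm (t - s))\<^sup>2"
      by linarith
  qed
qed

text \<open>
  If \<open>y\<close>, \<open>y'\<close> are the starting points belonging to \<open>(s, x)\<close>, \<open>(t, x')\<close>, then \<open>|y - y'|\<close> is at most
  \<open>\<kappa>\<close> times the distance of their positions at the common time \<open>t\<close>, that is, of \<open>X(t, y)\<close> and \<open>x'\<close>.
  And \<open>X(t, y)\<close> is within \<open>O(|t - s|)\<close> of \<open>x = X(s, y)\<close>, because characteristics starting in a bounded
  set have bounded speed.
\<close>

lemma q_locally_lipschitz: "locally_lipschitz_on ({0..T} \<times> V) (\<lambda>(s, x). q s x)"
proof (rule locally_lipschitz_onI_bounded)
  fix R :: real assume R: "R > 0"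
  obtain B where B: "B \<ge> 0" "\<And>y s t. y \<in> V \<Longrightarrow> s \<in> {0..T} \<Longrightarrow> t \<in> {0..T} \<Longrightarrow>
      norm (traj y t - traj y s) \<le> (B + L * E * norm y) * \<bar>t - s\<bar>"
    using traj_time_lipschitz by blast
  \<comment> \<open>\<open>b\<close> bounds the starting points of characteristics that meet the ball of radius \<open>R\<close>, and \<open>c\<close> their speed.\<close>
  define b where "b = \<kappa> * (R + B * T)"
  define c where "c = B + L * E * b"
  have b0: "b \<ge> 0" using \<kappa>_pos R B T_pos by (simp add: b_def)
  then have c0: "c \<ge> 0" using L_nonneg E_pos B by (simp add: c_def)
  have Sb: "norm (S s x) \<le> b" if "s \<in> {0..T}" "x \<in> V" "norm x \<le> R" for s x
  proof -
    have "norm (S s x - 0) \<le> \<kappa> * norm (X s (S s x) - X s 0)"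
      by (intro X_lower_bound V_intros S_in that)
    also have "norm (X s (S s x) - X s 0) \<le> norm x + norm (X s 0)"
      using norm_triangle_ineq4[of x "X s 0"] that by (simp add: X_S)
    also have "norm (X s 0) \<le> norm (traj 0 s - traj 0 0)"
      by (simp add: traj_eq X_0 norm_fst_le)
    also have "\<dots> \<le> (B + L * E * norm (0::'a)) * \<bar>s - 0\<bar>"
      using that T_pos by (intro B) auto
    also have "\<dots> \<le> B * T" using that B by (auto intro: mult_left_mono)
    finally have "norm (S s x) \<le> \<kappa> * (norm x + B * T)" using \<kappa>_pos by simp
    also have "\<dots> \<le> b" unfolding b_def using that \<kappa>_pos by (intro mult_left_mono) auto
    finally show ?thesis .
  qed
  have move: "norm (traj (S s x) t - traj (S s x) s) \<le> c * \<bar>t - s\<bar>"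
    if "s \<in> {0..T}" "t \<in> {0..T}" "x \<in> V" "norm x \<le> R" for s t x
  proof -
    have "norm (traj (S s x) t - traj (S s x) s) \<le> (B + L * E * norm (S s x)) * \<bar>t - s\<bar>"
      by (intro B S_in that)
    also have "\<dots> \<le> c * \<bar>t - s\<bar>"
      unfolding c_def using Sb that L_nonneg E_pos by (intro mult_right_mono add_left_mono mult_left_mono) auto
    finally show ?thesis .
  qed
  let ?C = "c + E * (\<kappa> * (c + 1))"
  have "?C-lipschitz_on (({0..T} \<times> V) \<inter> cball 0 R) (\<lambda>(s, x). q s x)"
  proof (rule lipschitz_onI)
    fix a a' assume a: "a \<in> ({0..T} \<times> V) \<inter> cball 0 R" "a' \<in> ({0..T} \<times> V) \<inter> cball 0 R"
    obtain s x t x' where eq: "a = (s, x)" "a' = (t, x')" by fastforce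
    have s: "s \<in> {0..T}" "t \<in> {0..T}" and x: "x \<in> V" "x' \<in> V" using a eq by auto
    have nx: "norm x \<le> R"
      using a eq norm_snd_le[of x s] by auto
    let ?y = "S s x" and ?y' = "S t x'" and ?d = "dist a a'"
    have y: "?y \<in> V" "?y' \<in> V" using S_in s x by auto
    have ds: "\<bar>t - s\<bar> \<le> ?d" "norm (x - x') \<le> ?d"
      using norm_fst_le[of "s - t" "x - x'"] norm_snd_le[of "x - x'" "s - t"] eq by (auto simp: dist_norm)
    have mv: "norm (X t ?y - X s ?y) \<le> c * \<bar>t - s\<bar>" "norm (P t ?y - P s ?y) \<le> c * \<bar>t - s\<bar>"
      using move[OF s x(1) nx] norm_fst_le[of "X t ?y - X s ?y" "P t ?y - P s ?y"]
        norm_snd_le[of "P t ?y - P s ?y" "X t ?y - X s ?y"] by (auto simp: traj_eq)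
    have cd: "c * \<bar>t - s\<bar> \<le> c * ?d" using ds c0 by (intro mult_left_mono)
    have "norm (?y - ?y') \<le> \<kappa> * norm (X t ?y - X t ?y')"
      by (intro X_lower_bound y s)
    also have "norm (X t ?y - X t ?y') \<le> norm (X t ?y - X s ?y) + norm (x - x')"
      using norm_triangle_ineq[of "X t ?y - X s ?y" "x - x'"] s x by (simp add: X_S)
    also have "\<dots> \<le> (c + 1) * ?d"
      using mv cd ds by (simp add: algebra_simps)
    finally have yy: "norm (?y - ?y') \<le> \<kappa> * ((c + 1) * ?d)" using \<kappa>_pos by simp
    have "norm (q s x - q t x') \<le> norm (P t ?y - P s ?y) + norm (P t ?y - P t ?y')"
      using norm_triangle_ineq[of "P s ?y - P t ?y" "P t ?y - P t ?y'"] by (simp add: q_def norm_minus_commute)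
    also have "norm (P t ?y - P t ?y') \<le> E * norm (?y - ?y')"
      by (intro P_lipschitz y s)
    also have "\<dots> \<le> E * (\<kappa> * ((c + 1) * ?d))"
      using yy E_pos by (intro mult_left_mono) auto
    finally have "norm (q s x - q t x') \<le> ?C * ?d"
      using mv cd by (simp add: algebra_simps)
    then show "dist (case a of (s, x) \<Rightarrow> q s x) (case a' of (s, x) \<Rightarrow> q s x) \<le> ?C * dist a a'"
      by (simp add: eq dist_norm)
  qed (use c0 E_pos \<kappa>_pos in auto)
  then show "\<exists>L. L-lipschitz_on (({0..T} \<times> V) \<inter> cball 0 R) (\<lambda>(s, x). q s x)" by blast
qed

end

section \<open>The classical solution\<close>

context hamilton_jacobi
begin

definition u :: "real \<Rightarrow> 'a \<Rightarrow> real" where "u t x = w (T - t) x"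

lemma reverse_time_deriv:
  fixes f :: "real \<Rightarrow> real"
  assumes "(f has_vector_derivative f') (at (T - t) within {0..T})"
  shows "((\<lambda>t. f (T - t)) has_vector_derivative - f') (at t within {0..T})"
proof -
  have eq: "(\<lambda>t. T - t) ` {0..T} = {0..T}"
    by (auto intro!: image_eqI[of _ _ "T - _"])
  have "((\<lambda>t. T - t) has_real_derivative - 1) (at t within {0..T})"
    by (auto intro!: derivative_eq_intros)
  from DERIV_image_chain[of f f' "\<lambda>t. T - t" t "{0..T}", OF _ this] assms
  show ?thesis
    by (simp add: eq has_real_derivative_iff_has_vector_derivative o_def)
qed

lemma u_time_deriv:
  assumes "t \<in> {0..T}" "x \<in> V"
  shows "((\<lambda>t. u t x) has_vector_derivative H x (q (T - t) x)) (at t within {0..T})"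
  unfolding u_def using reverse_time_deriv[OF w_time_deriv[of "T - t" x]] assms by simp

lemma u_space_deriv:
  assumes "t \<in> {0..T}" "x \<in> V"
  shows "(u t has_derivative (\<lambda>h. inner (q (T - t) x) h)) (at x within V)"
  using w_space_deriv[of "T - t" x] assms by (simp add: u_def[abs_def])

lemma time_deriv_u: "t \<in> {0..T} \<Longrightarrow> x \<in> V \<Longrightarrow> time_deriv T u t x = H x (q (T - t) x)"
  unfolding time_deriv_def
  by (rule vector_derivative_within_closed_interval[OF T_pos _ u_time_deriv])

lemma space_grad_u: "t \<in> {0..T} \<Longrightarrow> x \<in> V \<Longrightarrow> space_grad V u t x = q (T - t) x"
  unfolding space_grad_def
  by (intro gradient_eqI subspace_V q_in u_space_deriv) auto

lemma u_terminal: "x \<in> V \<Longrightarrow> u T x = G x"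
  using S_X[of 0 x] T_pos by (simp add: u_def w_def U_def X_0)

lemma classical_solution_u: "classical_solution V H G T u"
proof -
  have rev: "locally_lipschitz_on ({0..T} \<times> V) (\<lambda>(t, x). (T - t, x))"
    unfolding locally_lipschitz_on_def
  proof (intro ballI exI conjI)
    fix a
    show "1-lipschitz_on (cball a 1 \<inter> {0..T} \<times> V) (\<lambda>(t, x). (T - t, x))"
      by (rule lipschitz_onI) (auto simp: dist_Pair_Pair dist_real_def abs_minus_commute)
  qed (rule zero_less_one)
  have img: "(\<lambda>(t, x). (T - t, x)) ` ({0..T} \<times> V) \<subseteq> {0..T} \<times> V"
    by auto
  have q: "locally_lipschitz_on ({0..T} \<times> V) (\<lambda>(t, x). q (T - t) x)"
    using locally_lipschitz_on_compose[OF rev q_locally_lipschitz img] by (simp add: split_def)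
  have pair: "locally_lipschitz_on ({0..T} \<times> V) (\<lambda>(t, x). (x, q (T - t) x))"
    unfolding locally_lipschitz_on_def
  proof
    fix a assume "a \<in> {0..T} \<times> V"
    then obtain r C where r: "r > 0" "C-lipschitz_on (cball a r \<inter> {0..T} \<times> V) (\<lambda>(t, x). q (T - t) x)"
      using q unfolding locally_lipschitz_on_def by blast
    have "1-lipschitz_on (cball a r \<inter> {0..T} \<times> V) snd"
      by (rule lipschitz_onI) (auto simp: dist_snd_le)
    from lipschitz_on_Pair[OF this r(2)]
    show "\<exists>r>0. \<exists>C. C-lipschitz_on (cball a r \<inter> {0..T} \<times> V) (\<lambda>(t, x). (x, q (T - t) x))"
      using r(1) by (auto simp: case_prod_beta)
  qed
  have "locally_lipschitz_on (V \<times> V) (\<lambda>(x, p). H x p)"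
    by (rule locally_lipschitz_on_lipschitz_gradient[OF subspace_imp_convex[OF subspace_VV] subspace_0[OF subspace_VV] H_deriv gH_lip])
  from locally_lipschitz_on_compose[OF pair this]
  have H: "locally_lipschitz_on ({0..T} \<times> V) (\<lambda>(t, x). H x (q (T - t) x))"
    using q_in by (auto simp: split_def image_subset_iff)
  have "locally_lipschitz_on ({0..T} \<times> V) (\<lambda>(t, x). time_deriv T u t x)"
    by (rule locally_lipschitz_on_cong[OF H]) (auto simp: time_deriv_u)
  moreover have "locally_lipschitz_on ({0..T} \<times> V) (\<lambda>(t, x). space_grad V u t x)"
    by (rule locally_lipschitz_on_cong[OF q]) (auto simp: space_grad_u)
  moreover have "(\<lambda>s. u s x) differentiable (at t within {0..T})" "u t differentiable (at x within V)"
    if "t \<in> {0..T}" "x \<in> V" for t x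
    using u_time_deriv[OF that] u_space_deriv[OF that]
    by (auto simp: differentiable_def has_vector_derivative_def)
  ultimately show ?thesis
    by (auto simp: classical_solution_def C11_loc_def time_deriv_u space_grad_u u_terminal)
qed

end

section \<open>Uniqueness\<close>

context hamilton_jacobi
begin

context
  fixes v :: "real \<Rightarrow> 'a \<Rightarrow> real"
  assumes v: "classical_solution V H G T v"
begin

definition vt :: "real \<Rightarrow> 'a \<Rightarrow> real" where "vt t x = time_deriv T v t x"
definition vx :: "real \<Rightarrow> 'a \<Rightarrow> 'a" where "vx t x = space_grad V v t x"

lemma v_time_deriv:
  "t \<in> {0..T} \<Longrightarrow> x \<in> V \<Longrightarrow> ((\<lambda>s. v s x) has_vector_derivative vt t x) (at t within {0..T})"
  using v by (auto simp: vt_def time_deriv_def classical_solution_def C11_loc_def vector_derivative_works)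

lemma vx_in: "t \<in> {0..T} \<Longrightarrow> x \<in> V \<Longrightarrow> vx t x \<in> V"
  and v_space_deriv: "t \<in> {0..T} \<Longrightarrow> x \<in> V \<Longrightarrow> (v t has_derivative (\<lambda>h. inner (vx t x) h)) (at x within V)"
  using v has_gradient[of "v t" x] by (auto simp: vx_def space_grad_def classical_solution_def C11_loc_def)

lemma v_equation: "0 < t \<Longrightarrow> t < T \<Longrightarrow> x \<in> V \<Longrightarrow> vt t x = H x (vx t x)"
  using v by (auto simp: vt_def vx_def classical_solution_def)

lemma vx_locally_lipschitz: "locally_lipschitz_on ({0..T} \<times> V) (\<lambda>(t, x). vx t x)"
  using v by (simp add: vx_def classical_solution_def C11_loc_def)

text \<open>
  The chain rule needs joint differentiability; it follows from the existence of the partial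
  derivatives and the continuity of the one in space.
\<close>

lemma v_along_curve:
  assumes s: "s \<in> {0..T}" and \<xi>: "(\<xi> has_vector_derivative \<xi>') (at s within {0..T})"
    and \<xi>V: "\<And>r. r \<in> {0..T} \<Longrightarrow> \<xi> r \<in> V"
  shows "((\<lambda>s. v (T - s) (\<xi> s)) has_vector_derivative
     - vt (T - s) (\<xi> s) + inner (vx (T - s) (\<xi> s)) \<xi>') (at s within {0..T})"
proof -
  let ?t = "T - s" and ?x = "\<xi> s"
  have t: "?t \<in> {0..T}" and x: "?x \<in> V" using s \<xi>V by auto
  have D: "((\<lambda>(t, x). v t x) has_derivative (\<lambda>(k, h). k *\<^sub>R vt ?t ?x + blinfun_apply (blinfun_inner_left (vx ?t ?x)) h))
      (at (?t, ?x) within {0..T} \<times> V)"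
  proof (rule has_derivative_partialsI)
    show "((\<lambda>t. v t ?x) has_derivative (\<lambda>k. k *\<^sub>R vt ?t ?x)) (at ?t within {0..T})"
      using v_time_deriv[OF t x] by (simp add: has_vector_derivative_def)
    show "(v t has_derivative blinfun_apply (blinfun_inner_left (vx t x))) (at x within V)"
      if "t \<in> {0..T}" "x \<in> V" for t x
      using v_space_deriv[OF that] by (simp add: inner_commute)
    have "continuous_on ({0..T} \<times> V) (\<lambda>z. blinfun_inner_left (case z of (t, x) \<Rightarrow> vx t x))"
      by (intro bounded_linear.continuous_on[OF bounded_linear_blinfun_inner_left]
          locally_lipschitz_on_imp_continuous_on vx_locally_lipschitz)
    then show "continuous (at (?t, ?x) within {0..T} \<times> V) (\<lambda>(t, x). blinfun_inner_left (vx t x))"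
      using t x by (simp add: continuous_on_eq_continuous_within split_def)
  qed (use x convex_V in auto)
  have c: "((\<lambda>s. (T - s, \<xi> s)) has_derivative (\<lambda>k. (- k, k *\<^sub>R \<xi>'))) (at s within {0..T})"
    using \<xi> by (auto simp: has_vector_derivative_def intro!: derivative_eq_intros)
  have "(\<lambda>s. (T - s, \<xi> s)) ` {0..T} \<subseteq> {0..T} \<times> V"
    using \<xi>V by auto
  from has_derivative_in_compose[OF c has_derivative_subset[OF D this]]
  show ?thesis
    by (simp add: has_vector_derivative_def inner_commute algebra_simps)
qed

text \<open>
  At \<open>s = 0\<close> both sides are the gradient of \<open>G\<close>. The gradient of \<open>v\<close> is only Lipschitz, so the
  discrepancy \<open>D\<close> of the two sides need not be differentiable in \<open>s\<close>. The difference
  \<open>v(X + \<epsilon> h) - v(X)\<close>, for a direction \<open>h\<close> and small \<open>\<epsilon>\<close>, is differentiable; by the equation its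
  derivative differs from that of \<open>\<epsilon> P \<bullet> h\<close> by at most \<open>\<epsilon> C |D| + O(\<epsilon>\<^sup>2)\<close>. Divided by \<open>\<epsilon>\<close>, this
  bounds the increments of \<open>D\<close> over an interval by \<open>C\<close> times its length times a bound for \<open>|D|\<close> on it.
\<close>

lemma vx_along_characteristic:
  assumes y: "y \<in> V" and s: "s \<in> {0..T}"
  shows "vx (T - s) (X s y) = P s y"
proof -
  define D where "D s = vx (T - s) (X s y) - P s y" for s
  let ?curve = "\<lambda>s. (T - s, X s y)"
  have X_cont: "continuous_on {0..T} (\<lambda>s. X s y)" and P_cont: "continuous_on {0..T} (\<lambda>s. P s y)"
    unfolding X_def P_def by (intro continuous_intros traj_continuous y)+
  have curve: "continuous_on {0..T} ?curve" "?curve ` {0..T} \<subseteq> {0..T} \<times> V"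
    using X_in[OF y] by (auto intro!: continuous_intros X_cont)
  obtain r N where r: "r > 0" and N0: "N \<ge> 0"
    and N: "\<And>z a. z \<in> ?curve ` {0..T} \<Longrightarrow> a \<in> {0..T} \<times> V \<Longrightarrow> dist z a < r \<Longrightarrow>
       dist (case z of (t, x) \<Rightarrow> vx t x) (case a of (t, x) \<Rightarrow> vx t x) \<le> N * dist z a"
    by (rule locally_lipschitz_on_compact_uniform[OF vx_locally_lipschitz
          compact_continuous_image[OF curve(1) compact_Icc] curve(2)]) blast
  define C where "C = (1 + N) * L"
  have "D s = 0"
  proof (rule vanishing_by_small_increments[OF _ _ _ _ s])
    have "continuous_on {0..T} (\<lambda>s. case ?curve s of (t, x) \<Rightarrow> vx t x)"
      by (rule continuous_on_compose2[OF locally_lipschitz_on_imp_continuous_on[OF vx_locally_lipschitz] curve])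
    then show "continuous_on {0..T} D"
      unfolding D_def by (auto intro!: continuous_intros P_cont)
    have "(G has_derivative (\<lambda>h. inner (vx T y) h)) (at y within V)"
      using v_space_deriv[of T y] T_pos y v
      by (auto simp: classical_solution_def elim!: has_derivative_transform[rotated 2])
    then have "vx T y = gG y"
      using gradient_eqI[OF subspace_V y _ G_deriv[OF y]] gradient_eqI[OF subspace_V y vx_in]
        gG_in y T_pos by (metis atLeastAtMost_iff less_eq_real_def)
    then show "D 0 = 0"
      by (simp add: D_def X_0 P_0 y)
    show "C \<ge> 0" using N0 L_nonneg by (simp add: C_def)
  next
    fix a b M assume ab: "0 \<le> a" "a \<le> b" "b \<le> T" and M: "\<And>r. r \<in> {a..b} \<Longrightarrow> norm (D r) \<le> M"
    define h where "h = sgn (D b - D a)"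
    have DV: "D s \<in> V" if "s \<in> {0..T}" for s
      using that by (auto simp: D_def intro!: V_intros vx_in X_in P_in y)
    have h: "h \<in> V" "norm h \<le> 1" "inner (D b - D a) h = norm (D b - D a)"
    proof -
      show "h \<in> V"
        using DV[of a] DV[of b] ab by (auto simp: h_def sgn_div_norm)
      show "norm h \<le> 1"
        by (simp add: h_def norm_sgn)
      show "inner (D b - D a) h = norm (D b - D a)"
        by (cases "D b = D a") (simp_all add: h_def sgn_div_norm dot_square_norm power2_eq_square)
    qed
    define \<psi> where "\<psi> \<epsilon> s = v (T - s) (X s y + \<epsilon> *\<^sub>R h) - v (T - s) (X s y) - \<epsilon> * inner (P s y) h" for \<epsilon> s
    define \<psi>' where "\<psi>' \<epsilon> s = (- vt (T - s) (X s y + \<epsilon> *\<^sub>R h) + inner (vx (T - s) (X s y + \<epsilon> *\<^sub>R h)) (snd (gH (traj y s))))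
        - (- vt (T - s) (X s y) + inner (vx (T - s) (X s y)) (snd (gH (traj y s))))
        - \<epsilon> * inner (- fst (gH (traj y s))) h" for \<epsilon> s
    have \<psi>_deriv: "(\<psi> \<epsilon> has_vector_derivative \<psi>' \<epsilon> s) (at s within {0..T})" if s: "s \<in> {0..T}" for \<epsilon> s
    proof -
      have 1: "((\<lambda>s. X s y + \<epsilon> *\<^sub>R h) has_vector_derivative snd (gH (traj y s))) (at s within {0..T})"
        using has_vector_derivative_add[OF X_deriv[OF y s] has_vector_derivative_const] by simp
      have 2: "((\<lambda>s. \<epsilon> * inner (P s y) h) has_vector_derivative \<epsilon> * inner (- fst (gH (traj y s))) h) (at s within {0..T})"
        by (intro bounded_linear.has_vector_derivative[OF bounded_linear_mult_right]
            bounded_linear.has_vector_derivative[OF bounded_linear_inner_left] P_deriv y s)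
      show ?thesis
        unfolding \<psi>_def \<psi>'_def
        by (intro has_vector_derivative_diff v_along_curve 1 2 s X_deriv y X_in V_intros h) 
    qed
    have bound: "norm (\<psi>' \<epsilon> s) \<le> \<epsilon> * (C * M) + \<epsilon>\<^sup>2 * (L * (1 + N)\<^sup>2)"
      if \<epsilon>: "0 < \<epsilon>" "\<epsilon> < r" and s: "a < s" "s < b" for \<epsilon> s
    proof -
      have s': "s \<in> {0..T}" "s \<in> {a..b}" "0 < T - s" "T - s < T" using s ab by auto
      let ?x = "X s y" and ?x' = "X s y + \<epsilon> *\<^sub>R h"
      \<comment> \<open>The gradient of \<open>H\<close> is compared at three points of phase space: on the characteristic (\<open>z0\<close>), on the
        graph of the gradient of \<open>v\<close> above the same position (\<open>z\<close>), and above the shifted position (\<open>z + \<delta>\<close>).\<close>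
      define z0 where "z0 = traj y s"
      define z where "z = (?x, vx (T - s) ?x)"
      define \<delta> where "\<delta> = (\<epsilon> *\<^sub>R h, vx (T - s) ?x' - vx (T - s) ?x)"
      have x: "?x \<in> V" "?x' \<in> V" using X_in y s' h by auto
      have zV: "z \<in> V \<times> V" "z + \<delta> \<in> V \<times> V" "z0 \<in> V \<times> V"
        using x vx_in[of "T - s"] s' traj(2)[OF y s'(1)] by (auto simp: z_def \<delta>_def z0_def)
      have dh: "norm (\<epsilon> *\<^sub>R h) \<le> \<epsilon>" using h \<epsilon> by (simp add: mult_left_le)
      have d: "dist (T - s, ?x) (T - s, ?x') \<le> \<epsilon>"
        using dh by (simp add: dist_Pair_Pair dist_norm)
      have mem: "(T - s, ?x) \<in> ?curve ` {0..T}" "(T - s, ?x') \<in> {0..T} \<times> V"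
        using s' x by auto
      have "norm (vx (T - s) ?x' - vx (T - s) ?x) \<le> N * dist (T - s, ?x) (T - s, ?x')"
        using N[OF mem le_less_trans[OF d \<epsilon>(2)]] by (simp add: dist_norm norm_minus_commute)
      also have "\<dots> \<le> N * \<epsilon>"
        by (rule mult_left_mono[OF d N0])
      finally have "norm (vx (T - s) ?x' - vx (T - s) ?x) \<le> N * \<epsilon>" .
      then have \<delta>: "norm \<delta> \<le> \<epsilon> * (1 + N)"
        using norm_Pair_le[of "\<epsilon> *\<^sub>R h" "vx (T - s) ?x' - vx (T - s) ?x"] dh
        by (simp add: \<delta>_def algebra_simps)
      have eq: "vt (T - s) ?x = H ?x (vx (T - s) ?x)" "vt (T - s) ?x' = H ?x' (vx (T - s) ?x')"
        using v_equation s' x by auto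
      have "\<psi>' \<epsilon> s = - (H ?x' (vx (T - s) ?x') - H ?x (vx (T - s) ?x) - inner (gH z) \<delta>) - inner \<delta> (gH z - gH z0)"
        unfolding \<psi>'_def eq
        by (simp add: z0_def[symmetric] \<delta>_def inner_prod_def inner_diff_left inner_diff_right inner_commute)
      moreover have "\<bar>H ?x' (vx (T - s) ?x') - H ?x (vx (T - s) ?x) - inner (gH z) \<delta>\<bar> \<le> L * (norm \<delta>)\<^sup>2"
        using taylor_lipschitz_gradient[OF subspace_imp_convex[OF subspace_VV] H_deriv gH_lip zV(1,2)]
        by (simp add: z_def \<delta>_def)
      moreover have "L * (norm \<delta>)\<^sup>2 \<le> L * (\<epsilon> * (1 + N))\<^sup>2"
        by (intro mult_left_mono power_mono \<delta> L_nonneg) auto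
      moreover have "\<bar>inner \<delta> (gH z - gH z0)\<bar> \<le> \<epsilon> * (1 + N) * (L * M)"
      proof -
        have "norm (gH z - gH z0) \<le> L * norm (z - z0)"
          by (rule lipschitz_on_normD[OF gH_lip]) (use zV in auto)
        also have "norm (z - z0) = norm (D s)"
          by (simp add: z_def z0_def traj_eq D_def norm_prod_def)
        also have "L * norm (D s) \<le> L * M"
          by (intro mult_left_mono M s' L_nonneg)
        finally have "norm \<delta> * norm (gH z - gH z0) \<le> (\<epsilon> * (1 + N)) * (L * M)"
          using \<delta> \<epsilon> N0 by (intro mult_mono) auto
        then show ?thesis
          using Cauchy_Schwarz_ineq2[of \<delta> "gH z - gH z0"] by linarith
      qed
      ultimately show ?thesis
        unfolding real_norm_def by (simp add: C_def power_mult_distrib mult_ac)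
    qed
    have incr: "\<psi> \<epsilon> b / \<epsilon> - \<psi> \<epsilon> a / \<epsilon> \<le> (C * M + \<epsilon> * (L * (1 + N)\<^sup>2)) * (b - a)"
      if \<epsilon>: "0 < \<epsilon>" "\<epsilon> < r" for \<epsilon>
    proof -
      have "norm (\<psi> \<epsilon> b - \<psi> \<epsilon> a) \<le> (\<epsilon> * (C * M) + \<epsilon>\<^sup>2 * (L * (1 + N)\<^sup>2)) * (b - a)"
      proof (rule increment_bound[OF ab(2), where f' = "\<psi>' \<epsilon>"])
        have "continuous_on {0..T} (\<psi> \<epsilon>)"
          by (rule continuous_on_vector_derivative[of _ _ "\<psi>' \<epsilon>"]) (rule \<psi>_deriv)
        then show "continuous_on {a..b} (\<psi> \<epsilon>)"
          by (rule continuous_on_subset) (use ab in auto)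
        show "(\<psi> \<epsilon> has_vector_derivative \<psi>' \<epsilon> s) (at s)" if "a < s" "s < b" for s
          using \<psi>_deriv[of s \<epsilon>] that ab at_within_Icc_at[of 0 s T] by auto
      qed (rule bound[OF \<epsilon>])
      also have "\<dots> = \<epsilon> * ((C * M + \<epsilon> * (L * (1 + N)\<^sup>2)) * (b - a))"
        by (simp add: algebra_simps power2_eq_square)
      finally have "\<psi> \<epsilon> b - \<psi> \<epsilon> a \<le> \<epsilon> * ((C * M + \<epsilon> * (L * (1 + N)\<^sup>2)) * (b - a))"
        by (simp add: abs_le_iff)
      then show ?thesis
        using \<epsilon> by (simp add: diff_divide_distrib[symmetric] divide_le_eq mult.commute)
    qed
    have lim: "((\<lambda>\<epsilon>. \<psi> \<epsilon> s / \<epsilon>) \<longlongrightarrow> inner (D s) h) (at_right 0)" if s: "s \<in> {0..T}" for s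
    proof -
      have t: "T - s \<in> {0..T}" and x: "X s y \<in> V" using s X_in y by auto
      have line: "((\<lambda>\<epsilon>. X s y + \<epsilon> *\<^sub>R h) has_derivative (\<lambda>\<epsilon>. \<epsilon> *\<^sub>R h)) (at (0::real))"
        by (auto intro!: derivative_eq_intros)
      have sub: "(\<lambda>\<epsilon>. X s y + \<epsilon> *\<^sub>R h) ` UNIV \<subseteq> V" using x h by auto
      have "(v (T - s) has_derivative (\<lambda>h. inner (vx (T - s) (X s y)) h))
          (at (X s y + 0 *\<^sub>R h) within (\<lambda>\<epsilon>. X s y + \<epsilon> *\<^sub>R h) ` UNIV)"
        unfolding scale_zero_left add_0_right by (rule has_derivative_subset[OF v_space_deriv[OF t x] sub])
      from has_derivative_in_compose[OF line this]
      have "((\<lambda>\<epsilon>. v (T - s) (X s y + \<epsilon> *\<^sub>R h)) has_derivative (\<lambda>\<epsilon>. inner (vx (T - s) (X s y)) (\<epsilon> *\<^sub>R h))) (at 0)" .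
      then have "((\<lambda>\<epsilon>. v (T - s) (X s y + \<epsilon> *\<^sub>R h)) has_real_derivative inner (vx (T - s) (X s y)) h) (at 0)"
        by (simp add: has_field_derivative_def mult_commute_abs)
      then have "((\<lambda>\<epsilon>. (v (T - s) (X s y + \<epsilon> *\<^sub>R h) - v (T - s) (X s y)) / \<epsilon>) \<longlongrightarrow> inner (vx (T - s) (X s y)) h) (at 0)"
        by (simp add: has_field_derivative_iff)
      then have "((\<lambda>\<epsilon>. (v (T - s) (X s y + \<epsilon> *\<^sub>R h) - v (T - s) (X s y)) / \<epsilon> - inner (P s y) h)
          \<longlongrightarrow> inner (D s) h) (at_right 0)"
        unfolding D_def inner_diff_left
        by (intro tendsto_diff tendsto_const) (simp add: filterlim_at_split)
      moreover have "\<forall>\<^sub>F \<epsilon> in at_right 0.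
          (v (T - s) (X s y + \<epsilon> *\<^sub>R h) - v (T - s) (X s y)) / \<epsilon> - inner (P s y) h = \<psi> \<epsilon> s / \<epsilon>"
        using eventually_at_right_less[of "0::real"]
        by eventually_elim (simp add: \<psi>_def diff_divide_distrib)
      ultimately show ?thesis
        by (rule Lim_transform_eventually)
    qed
    have "inner (D b) h - inner (D a) h \<le> (C * M + 0 * (L * (1 + N)\<^sup>2)) * (b - a)"
    proof (rule tendsto_le)
      show "((\<lambda>\<epsilon>. \<psi> \<epsilon> b / \<epsilon> - \<psi> \<epsilon> a / \<epsilon>) \<longlongrightarrow> inner (D b) h - inner (D a) h) (at_right 0)"
        by (intro tendsto_diff lim) (use ab in auto)
      show "((\<lambda>\<epsilon>. (C * M + \<epsilon> * (L * (1 + N)\<^sup>2)) * (b - a)) \<longlongrightarrow> (C * M + 0 * (L * (1 + N)\<^sup>2)) * (b - a)) (at_right 0)"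
        by (intro tendsto_intros)
      show "\<forall>\<^sub>F \<epsilon> in at_right 0. \<psi> \<epsilon> b / \<epsilon> - \<psi> \<epsilon> a / \<epsilon> \<le> (C * M + \<epsilon> * (L * (1 + N)\<^sup>2)) * (b - a)"
        using eventually_at_right_real[OF r] by eventually_elim (auto intro: incr)
    qed simp
    then show "norm (D b - D a) \<le> C * M * (b - a)"
      using h(3) by (simp add: inner_diff_left)
  qed
  then show ?thesis by (simp add: D_def)
qed

text \<open>
  The characteristics fill the space, so the gradients of \<open>v\<close> and \<open>u\<close> agree everywhere; by the
  equation so do the time derivatives, and the terminal values are the same.
\<close>

lemma classical_solution_unique:
  assumes t: "t \<in> {0..T}" and x: "x \<in> V"
  shows "v t x = u t x"
proof -
  have grad: "vx t x = q (T - t) x" if "t \<in> {0..T}" for t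
    using vx_along_characteristic[of "S (T - t) x" "T - t"] that x by (simp add: S_in X_S q_def)
  have d: "((\<lambda>t. v t x - u t x) has_vector_derivative vt t x - H x (q (T - t) x)) (at t within {0..T})"
    if "t \<in> {0..T}" for t
    by (intro has_vector_derivative_diff v_time_deriv u_time_deriv that x)
  have "norm ((v T x - u T x) - (v t x - u t x)) \<le> 0 * (T - t)"
  proof (rule increment_bound[of t T "\<lambda>t. v t x - u t x"])
    have "continuous_on {0..T} (\<lambda>t. v t x - u t x)"
      using d by (rule continuous_on_vector_derivative)
    then show "continuous_on {t..T} (\<lambda>t. v t x - u t x)"
      by (rule continuous_on_subset) (use t in auto)
    fix r assume r: "t < r" "r < T"
    then have r': "0 < r" "r \<in> {0..T}" using t by auto
    have "vt r x - H x (q (T - r) x) = 0"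
      using v_equation[OF r'(1) r(2) x] grad[OF r'(2)] by simp
    then show "((\<lambda>t. v t x - u t x) has_vector_derivative 0) (at r)"
      using d[OF r'(2)] at_within_Icc_at[OF r'(1) r(2)] by simp
  qed (use t in auto)
  moreover have "v T x = G x" using v x by (simp add: classical_solution_def)
  ultimately show ?thesis using u_terminal[OF x] by simp
qed

end

theorem well_posed_hamilton_jacobi: "well_posed V H G T"
  unfolding well_posed_def
  using classical_solution_u classical_solution_unique by blast

end

section \<open>Large drift and large concave potentials\<close>

text \<open>
  The coefficient of \<open>- |\<delta>X|\<^sup>2\<close> that \<open>\<alpha>\<close> has to beat, with weight \<open>m = a + 1\<close>: direct terms first, then
  the price of absorbing \<open>|\<delta>X| |\<delta>P|\<close> into \<open>c |\<delta>P|\<^sup>2\<close>. The absolute value and the summand \<open>1\<close> make it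
  positive for all arguments.
\<close>

definition threshold :: "real \<Rightarrow> real \<Rightarrow> real \<Rightarrow> real" where
  "threshold a b c = 1 + \<bar>b + 2 * (a + 1) * b + (b + (a + 1) * b)\<^sup>2 / c\<bar>"

lemma young_absorption:
  fixes b c m x y :: real
  assumes "c > 0"
  shows "- ((b + m * b)\<^sup>2 / c) * x\<^sup>2 \<le> c * y\<^sup>2 - 2 * (b + m * b) * x * y"
proof -
  have "0 \<le> (c * y - (b + m * b) * x)\<^sup>2 / c"
    using assms by simp
  also have "\<dots> = c * y\<^sup>2 - 2 * (b + m * b) * x * y + ((b + m * b)\<^sup>2 / c) * x\<^sup>2"
    using assms by (simp add: field_simps power2_eq_square)
  finally show ?thesis by simp
qed

locale admissible = projected_subspace V \<pi>
  for V :: "'a::{real_inner, banach} set" and \<pi> :: "'a \<Rightarrow> 'a" +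
  fixes H :: "'a \<Rightarrow> 'a \<Rightarrow> real" and G :: "'a \<Rightarrow> real" and c\<^sub>0 \<alpha> T :: real
  assumes data: "admissible_data V H G c\<^sub>0"
    and large: "threshold (hessian_norm V G) (hessian_norm (V \<times> V) (\<lambda>(x, p). H x p)) c\<^sub>0 < \<alpha>"
    and T_pos: "0 < T"
begin

sublocale VV: projected_subspace "V \<times> V" "\<lambda>z. (\<pi> (fst z), \<pi> (snd z))"
  by (rule projected_subspace_Times)

abbreviation "a \<equiv> hessian_norm V G"
abbreviation "b \<equiv> hessian_norm (V \<times> V) (\<lambda>(x, p). H x p)"
abbreviation "gG \<equiv> gradient V G"
abbreviation "gH \<equiv> gradient (V \<times> V) (\<lambda>(x, p). H x p)"

lemma ab_nonneg: "0 \<le> a" "0 \<le> b" and c_pos: "0 < c\<^sub>0"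
  using data hessian_norm_nonneg VV.hessian_norm_nonneg by (auto simp: admissible_data_def)

lemma alpha_pos: "0 < \<alpha>"
  using large by (simp add: threshold_def)

lemma gH_in: "z \<in> V \<times> V \<Longrightarrow> gH z \<in> V \<times> V"
  and gH_deriv: "z \<in> V \<times> V \<Longrightarrow> ((\<lambda>(x, p). H x p) has_derivative (\<lambda>h. inner (gH z) h)) (at z within V \<times> V)"
  and gH_lip: "b-lipschitz_on (V \<times> V) gH"
  using data VV.C2_on_gradient VV.gradient_lipschitz by (auto simp: admissible_data_def C2_on_def)

lemma gG_in: "x \<in> V \<Longrightarrow> gG x \<in> V"
  and gG_deriv: "x \<in> V \<Longrightarrow> (G has_derivative (\<lambda>h. inner (gG x) h)) (at x within V)"
  and gG_lip: "a-lipschitz_on V gG"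
  using data C2_on_gradient gradient_lipschitz by (auto simp: admissible_data_def C2_on_def)

lemma G_semiconvex:
  assumes "x \<in> V" "x' \<in> V"
  shows "(norm (x' - x))\<^sup>2 \<le> inner (x' - x) (gG x' - gG x) + (a + 1) * (norm (x' - x))\<^sup>2"
proof -
  have "norm (x' - x) * norm (gG x' - gG x) \<le> norm (x' - x) * (a * norm (x' - x))"
    by (intro mult_left_mono lipschitz_on_normD[OF gG_lip] assms) auto
  then show ?thesis
    using Cauchy_Schwarz_ineq2[of "x' - x" "gG x' - gG x"]
    by (simp add: algebra_simps power2_eq_square)
qed

text \<open>
  How far \<open>H\<close> alone may violate the monotonicity condition. In \<open>\<delta>P \<bullet> \<delta>H\<^sub>p\<close> the change of \<open>p\<close> at fixed
  \<open>x'\<close> gives at least \<open>c\<^sub>0 |\<delta>P|\<^sup>2\<close>, and the change of \<open>x\<close> at fixed \<open>p\<close> at least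
  \<open>- b |\<delta>X| |\<delta>P|\<close>. The other terms contain the factor \<open>\<delta>X\<close> and are estimated by the Lipschitz
  constant \<open>b\<close> of the gradient.
\<close>

lemma H_mono_deficit:
  assumes z: "z \<in> V \<times> V" "z' \<in> V \<times> V"
  shows "- \<alpha> * (norm (fst z' - fst z))\<^sup>2 \<le>
      inner (snd z' - snd z) (snd (gH z') - snd (gH z)) - inner (fst z' - fst z) (fst (gH z') - fst (gH z))
      + 2 * (a + 1) * inner (fst z' - fst z) (snd (gH z') - snd (gH z))"
proof -
  obtain x p x' p' where eq: "z = (x, p)" "z' = (x', p')" by fastforce
  have V: "x \<in> V" "p \<in> V" "x' \<in> V" "p' \<in> V" using z eq by auto
  let ?\<xi> = "norm (x' - x)" and ?\<eta> = "norm (p' - p)"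
  have "norm (z' - z) \<le> ?\<xi> + ?\<eta>"
    using norm_Pair_le[of "x' - x" "p' - p"] by (simp add: eq)
  moreover have "norm (gH z' - gH z) \<le> b * norm (z' - z)"
    by (rule lipschitz_on_normD[OF gH_lip z(2,1)])
  ultimately have "norm (gH z' - gH z) \<le> b * (?\<xi> + ?\<eta>)"
    using ab_nonneg by (meson mult_left_mono order_trans)
  moreover have "norm (fst w) \<le> norm w" "norm (snd w) \<le> norm w" for w :: "'a \<times> 'a"
    by (metis norm_fst_le prod.collapse, metis norm_snd_le prod.collapse)
  from this[of "gH z' - gH z"]
  have "norm (fst (gH z') - fst (gH z)) \<le> norm (gH z' - gH z)" "norm (snd (gH z') - snd (gH z)) \<le> norm (gH z' - gH z)"
    by simp_all
  ultimately have g: "norm (fst (gH z') - fst (gH z)) \<le> b * (?\<xi> + ?\<eta>)" "norm (snd (gH z') - snd (gH z)) \<le> b * (?\<xi> + ?\<eta>)"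
    by linarith+
  have i: "\<bar>inner (x' - x) w\<bar> \<le> ?\<xi> * (b * (?\<xi> + ?\<eta>))" if "norm w \<le> b * (?\<xi> + ?\<eta>)" for w
    using Cauchy_Schwarz_ineq2[of "x' - x" w] mult_left_mono[OF that, of ?\<xi>] by simp
  have 1: "inner (x' - x) (fst (gH z') - fst (gH z)) \<le> ?\<xi> * (b * (?\<xi> + ?\<eta>))"
    using i[OF g(1)] by linarith
  have "- (?\<xi> * (b * (?\<xi> + ?\<eta>))) \<le> inner (x' - x) (snd (gH z') - snd (gH z))"
    using i[OF g(2)] by linarith
  then have 2: "2 * (a + 1) * - (?\<xi> * (b * (?\<xi> + ?\<eta>))) \<le> 2 * (a + 1) * inner (x' - x) (snd (gH z') - snd (gH z))"
    using ab_nonneg by (intro mult_left_mono) auto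
  have 3: "c\<^sub>0 * ?\<eta>\<^sup>2 - ?\<eta> * (b * ?\<xi>) \<le> inner (p' - p) (snd (gH z') - snd (gH z))"
  proof -
    have "c\<^sub>0 * ?\<eta>\<^sup>2 \<le> inner (p' - p) (snd (gH (x', p')) - snd (gH (x', p)))"
      using data V by (intro strong_monotonicity_in_p) (auto simp: admissible_data_def)
    moreover have "- (?\<eta> * (b * ?\<xi>)) \<le> inner (p' - p) (snd (gH (x', p)) - snd (gH (x, p)))"
    proof -
      have "norm (snd (gH (x', p)) - snd (gH (x, p))) \<le> norm (gH (x', p) - gH (x, p))"
        by (metis norm_snd_le prod.collapse snd_diff)
      also have "\<dots> \<le> b * norm ((x', p) - (x, p))"
        by (rule lipschitz_on_normD[OF gH_lip]) (use V in auto)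
      finally have "?\<eta> * norm (snd (gH (x', p)) - snd (gH (x, p))) \<le> ?\<eta> * (b * ?\<xi>)"
        by (intro mult_left_mono) (auto simp: norm_prod_def)
      then show ?thesis
        using Cauchy_Schwarz_ineq2[of "p' - p" "snd (gH (x', p)) - snd (gH (x, p))"] by linarith
    qed
    ultimately show ?thesis
      unfolding eq by (simp add: inner_diff_right)
  qed
  have "- \<alpha> * ?\<xi>\<^sup>2 \<le> - (b + 2 * (a + 1) * b + (b + (a + 1) * b)\<^sup>2 / c\<^sub>0) * ?\<xi>\<^sup>2"
    using large unfolding threshold_def by (intro mult_right_mono) auto
  also have "\<dots> = - ((b + (a + 1) * b)\<^sup>2 / c\<^sub>0) * ?\<xi>\<^sup>2 - (b + 2 * (a + 1) * b) * ?\<xi>\<^sup>2"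
    by (simp add: algebra_simps)
  also have "\<dots> \<le> c\<^sub>0 * ?\<eta>\<^sup>2 - 2 * (b + (a + 1) * b) * ?\<xi> * ?\<eta> - (b + 2 * (a + 1) * b) * ?\<xi>\<^sup>2"
    using young_absorption[OF c_pos, of b "a + 1" ?\<xi> ?\<eta>] by simp
  also have "\<dots> = (c\<^sub>0 * ?\<eta>\<^sup>2 - ?\<eta> * (b * ?\<xi>)) - ?\<xi> * (b * (?\<xi> + ?\<eta>)) + 2 * (a + 1) * - (?\<xi> * (b * (?\<xi> + ?\<eta>)))"
    by (simp add: algebra_simps power2_eq_square)
  finally show ?thesis
    using 1 2 3 by (simp add: eq)
qed

text \<open>
  For the added gradient \<open>\<alpha> (p, x)\<close> the monotonicity expression is \<open>2 (a + 1) \<alpha> |\<delta>X|\<^sup>2\<close>.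
\<close>

lemma well_posed_transport: "well_posed V (\<lambda>x p. H x p + \<alpha> * inner x p) G T"
proof -
  interpret hamilton_jacobi V \<pi> "\<lambda>x p. H x p + \<alpha> * inner x p"
    "\<lambda>z. gH z + \<alpha> *\<^sub>R (snd z, fst z)" G gG "b + \<alpha> * 1" a "a + 1" T
  proof unfold_locales
    fix z assume z: "z \<in> V \<times> V"
    have "((\<lambda>z. (case z of (x, p) \<Rightarrow> H x p) + \<alpha> * inner (fst z) (snd z)) has_derivative
        (\<lambda>h. inner (gH z) h + \<alpha> * (inner (fst z) (snd h) + inner (fst h) (snd z)))) (at z within V \<times> V)"
      by (intro has_derivative_add gH_deriv z has_derivative_mult_right has_derivative_inner
          has_derivative_fst has_derivative_snd has_derivative_ident)
    moreover have "inner (gH z + \<alpha> *\<^sub>R (snd z, fst z)) h = inner (gH z) h + \<alpha> * (inner (fst z) (snd h) + inner (fst h) (snd z))" for h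
    proof -
      have "inner (snd z, fst z) h = inner (fst z) (snd h) + inner (fst h) (snd z)"
        by (simp add: inner_prod_def inner_commute)
      then show ?thesis
        by (simp only: inner_add_left inner_scaleR_left)
    qed
    ultimately show "((\<lambda>(x, p). H x p + \<alpha> * inner x p) has_derivative (\<lambda>h. inner (gH z + \<alpha> *\<^sub>R (snd z, fst z)) h)) (at z within V \<times> V)"
      by (simp only: split_def)
    show "gH z + \<alpha> *\<^sub>R (snd z, fst z) \<in> V \<times> V"
      using z gH_in[OF z] by (auto simp: mem_Times_iff)
    fix z' assume z': "z' \<in> V \<times> V"
    have "\<alpha> * (norm (fst z' - fst z))\<^sup>2 \<le> 2 * (a + 1) * \<alpha> * (norm (fst z' - fst z))\<^sup>2"
      using alpha_pos ab_nonneg by (intro mult_right_mono) auto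
    then show "0 \<le> inner (snd z' - snd z) (snd (gH z' + \<alpha> *\<^sub>R (snd z', fst z')) - snd (gH z + \<alpha> *\<^sub>R (snd z, fst z)))
        - inner (fst z' - fst z) (fst (gH z' + \<alpha> *\<^sub>R (snd z', fst z')) - fst (gH z + \<alpha> *\<^sub>R (snd z, fst z)))
        + 2 * (a + 1) * inner (fst z' - fst z) (snd (gH z' + \<alpha> *\<^sub>R (snd z', fst z')) - snd (gH z + \<alpha> *\<^sub>R (snd z, fst z)))"
      using H_mono_deficit[OF z z']
      by (simp add: inner_add_left inner_add_right inner_diff_left inner_diff_right inner_commute
          power2_norm_eq_inner algebra_simps)
  next
    have "1-lipschitz_on (V \<times> V) (\<lambda>z. (snd z, fst z))"
      by (rule lipschitz_onI) (auto simp: dist_Pair_Pair add.commute)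
    then show "(b + \<alpha> * 1)-lipschitz_on (V \<times> V) (\<lambda>z. gH z + \<alpha> *\<^sub>R (snd z, fst z))"
      using alpha_pos by (intro lipschitz_on_add gH_lip lipschitz_on_cmult_nonneg) auto
  qed (use gG_deriv gG_in gG_lip G_semiconvex ab_nonneg T_pos in auto)
  show ?thesis by (rule well_posed_hamilton_jacobi)
qed

text \<open>
  For the added gradient \<open>- \<alpha> (x, 0)\<close> the monotonicity expression is \<open>\<alpha> |\<delta>X|\<^sup>2\<close>.
\<close>

lemma well_posed_potential: "well_posed V (\<lambda>x p. H x p - \<alpha> * ((norm x)\<^sup>2 / 2)) G T"
proof -
  interpret hamilton_jacobi V \<pi> "\<lambda>x p. H x p - \<alpha> * ((norm x)\<^sup>2 / 2)"
    "\<lambda>z. gH z + (- \<alpha>) *\<^sub>R (fst z, 0)" G gG "b + \<alpha> * 1" a "a + 1" T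
  proof unfold_locales
    fix z assume z: "z \<in> V \<times> V"
    have "((\<lambda>z. (case z of (x, p) \<Rightarrow> H x p) - \<alpha> / 2 * inner (fst z) (fst z)) has_derivative
        (\<lambda>h. inner (gH z) h - \<alpha> / 2 * (inner (fst z) (fst h) + inner (fst h) (fst z)))) (at z within V \<times> V)"
      by (intro has_derivative_diff gH_deriv z has_derivative_mult_right has_derivative_inner
          has_derivative_fst has_derivative_ident)
    moreover have "inner (gH z + (- \<alpha>) *\<^sub>R (fst z, 0)) h = inner (gH z) h - \<alpha> / 2 * (inner (fst z) (fst h) + inner (fst h) (fst z))" for h
    proof -
      have "inner (fst z, 0) h = inner (fst z) (fst h)"
        by (simp add: inner_prod_def)
      then show ?thesis
        unfolding inner_add_left inner_scaleR_left by (simp add: inner_commute)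
    qed
    moreover have "\<alpha> / 2 * inner x x = \<alpha> * ((norm x)\<^sup>2 / 2)" for x :: 'a
      by (simp add: power2_norm_eq_inner)
    ultimately show "((\<lambda>(x, p). H x p - \<alpha> * ((norm x)\<^sup>2 / 2)) has_derivative (\<lambda>h. inner (gH z + (- \<alpha>) *\<^sub>R (fst z, 0)) h)) (at z within V \<times> V)"
      by (simp only: split_def)
    show "gH z + (- \<alpha>) *\<^sub>R (fst z, 0) \<in> V \<times> V"
      using z gH_in[OF z] by (auto simp: mem_Times_iff)
    fix z' assume z': "z' \<in> V \<times> V"
    show "0 \<le> inner (snd z' - snd z) (snd (gH z' + (- \<alpha>) *\<^sub>R (fst z', 0)) - snd (gH z + (- \<alpha>) *\<^sub>R (fst z, 0)))
        - inner (fst z' - fst z) (fst (gH z' + (- \<alpha>) *\<^sub>R (fst z', 0)) - fst (gH z + (- \<alpha>) *\<^sub>R (fst z, 0)))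
        + 2 * (a + 1) * inner (fst z' - fst z) (snd (gH z' + (- \<alpha>) *\<^sub>R (fst z', 0)) - snd (gH z + (- \<alpha>) *\<^sub>R (fst z, 0)))"
      using H_mono_deficit[OF z z']
      by (simp add: inner_add_left inner_add_right inner_diff_left inner_diff_right inner_commute
          power2_norm_eq_inner algebra_simps)
  next
    have "1-lipschitz_on (V \<times> V) (\<lambda>z. (fst z, 0 :: 'a))"
      by (rule lipschitz_onI) (auto simp: dist_Pair_Pair dist_fst_le)
    then show "(b + \<alpha> * 1)-lipschitz_on (V \<times> V) (\<lambda>z. gH z + (- \<alpha>) *\<^sub>R (fst z, 0))"
      using lipschitz_on_cmult[of 1 "V \<times> V" "\<lambda>z. (fst z, 0 :: 'a)" "- \<alpha>"] alpha_pos
      by (intro lipschitz_on_add gH_lip) auto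
  qed (use gG_deriv gG_in gG_lip G_semiconvex ab_nonneg T_pos in auto)
  show ?thesis by (rule well_posed_hamilton_jacobi)
qed

end

section \<open>Well-posedness in every dimension\<close>

lemma projected_subspace_Rd: "projected_subspace (Rd d) (trunc d)"
  by (rule projected_subspace.intro)
    (auto intro: subspace_Rd bounded_linear_trunc trunc_in_Rd trunc_id riesz_Rd)

theorem corollary1p2:
  shows
    "(\<exists>C :: real \<Rightarrow> real \<Rightarrow> real \<Rightarrow> real. (\<forall>a b c. C a b c > 0) \<and>
       (\<forall>d\<ge>1. \<forall>(H :: l2 \<Rightarrow> l2 \<Rightarrow> real) (G :: l2 \<Rightarrow> real) (c\<^sub>0 :: real).
          admissible_data (Rd d) H G c\<^sub>0 \<longrightarrow>
          (\<forall>\<alpha> > C (hessian_norm (Rd d) G) (hessian_norm (Rd d \<times> Rd d) (\<lambda>(x, p). H x p)) c\<^sub>0.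
             \<forall>T>0. well_posed (Rd d) (\<lambda>x p. H x p + \<alpha> * inner x p) G T)))
     \<and>
     (\<exists>C :: real \<Rightarrow> real \<Rightarrow> real \<Rightarrow> real. (\<forall>a b c. C a b c > 0) \<and>
       (\<forall>d\<ge>1. \<forall>(H :: l2 \<Rightarrow> l2 \<Rightarrow> real) (G :: l2 \<Rightarrow> real) (c\<^sub>0 :: real).
          admissible_data (Rd d) H G c\<^sub>0 \<longrightarrow>
          (\<forall>\<alpha> > C (hessian_norm (Rd d) G) (hessian_norm (Rd d \<times> Rd d) (\<lambda>(x, p). H x p)) c\<^sub>0.
             \<forall>T>0. well_posed (Rd d) (\<lambda>x p. H x p - \<alpha> * ((norm x)\<^sup>2 / 2)) G T)))"
proof -
  have pos: "\<forall>a b c. threshold a b c > 0"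
    by (simp add: threshold_def add_pos_nonneg)
  have "well_posed (Rd d) (\<lambda>x p. H x p + \<alpha> * inner x p) G T"
    "well_posed (Rd d) (\<lambda>x p. H x p - \<alpha> * ((norm x)\<^sup>2 / 2)) G T"
    if "admissible_data (Rd d) H G c\<^sub>0"
      "threshold (hessian_norm (Rd d) G) (hessian_norm (Rd d \<times> Rd d) (\<lambda>(x, p). H x p)) c\<^sub>0 < \<alpha>" "0 < T"
    for d H G c\<^sub>0 \<alpha> T
  proof -
    interpret projected_subspace "Rd d" "trunc d" by (rule projected_subspace_Rd)
    interpret admissible "Rd d" "trunc d" H G c\<^sub>0 \<alpha> T by unfold_locales (use that in auto)
    show "well_posed (Rd d) (\<lambda>x p. H x p + \<alpha> * inner x p) G T"
      by (rule well_posed_transport)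
    show "well_posed (Rd d) (\<lambda>x p. H x p - \<alpha> * ((norm x)\<^sup>2 / 2)) G T"
      by (rule well_posed_potential)
  qed
  with pos show ?thesis by blast
qed

end
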